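(* Let $(E,(\cdot,\cdot),\mathcal H)$ be an extended affine Lie algebra (of reduced type) with root system $R$, of simply laced type and of rank $>1$, and let $\Psi$ be a finite order Cartan automorphism of $E$. Then (i) $\Psi$ is diagonal; (ii) the core-character $\psi:R\to\mathbb C^\times$ associated to $\Psi$ is a character.
   Context: All vector spaces are over $\mathbb C$. An extended affine Lie algebra is a triple $(E,(\cdot,\cdot),\mathcal H)$ where $E$ is a Lie algebra, $\mathcal H$ is a non-trivial finite dimensional subalgebra and $(\cdot,\cdot)$ is a symmetric bilinear form on $E$ such that: (A1) the form is invariant and non-degenerate; (A2) $E=\sum_{\alpha\in R}E_\alpha$ with $E_\alpha=\{x\in E\mid [h,x]=\alpha(h)x\ \forall h\in\mathcal H\}$, $R=\{\alpha\in\mathcal H^\star\mid E_\alpha\neq\{0\}\}$ and $E_0=\mathcal H$ ($R$ is the root system of $E$); the form restricted to $\mathcal H$ is then non-degenerate, $t_\alpha\in\mathcal H$ is defined by $\alpha(h)=(h,t_\alpha)$, and $(\alpha,\beta):=(t_\alpha,t_\beta)$ on $\mathcal H^\star$; $R^0=\{\alpha\in R\mid(\alpha,\alpha)=0\}$ (isotropic roots), $R^\times=R\setminus R^0$ (non-isotropic roots), and the core $E_c$ is the subalgebra generated by $E_\alpha$, $\alpha\in R^\times$; (A3) $\mathrm{ad}(x)$ is locally nilpotent for $x\in E_\alpha$, $\alpha\in R^\times$; (A4) (tameness) the centralizer of $E_c$ in $E$ is contained in $E_c$; (A5) the $\mathbb Z$-span of $R$ is a free abelian group of finite rank; (A6)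 if $R^\times=R_1\uplus R_2$ with $R_1,R_2$ non-empty then $R_1\not\perp R_2$. Let $\mathcal V=\mathrm{span}_{\mathbb R}R$, $\mathcal V^0=\mathrm{span}_{\mathbb R}R^0$. The image $\bar R$ of $R$ in $\mathcal V/\mathcal V^0$ is an irreducible finite root system; its rank and type are called the rank and type of $R$ (and of $E$). Reduced type means $\bar R$ is reduced. Simply laced types are $A_\ell,D_\ell,E_6,E_7,E_8$. A Cartan automorphism of $E$ is an automorphism $\Psi$ with $\Psi(h)=h$ for all $h\in\mathcal H$; it stabilizes each root space. It is diagonal if it acts as a scalar multiple of the identity on each root space. For $\alpha\in R^\times$ ($\dim E_\alpha=1$) define $\eta_\alpha\in\mathbb C^\times$ by $\Psi(x)=\eta_\alpha x$, $x\in E_\alpha$. If $\Psi$ is a finite order diagonal automorphism, its associated core-character is $\psi:R\to\mathbb C^\times$, $\psi(\alpha)=\eta_\alpha$, where for $\sigma\in R^0$, $\eta_\sigma:=\eta_{\alpha+\sigma}\eta_{-\alpha}$ for some $\alpha\in R^\times$ with $\alpha+\sigma\in R^\times$ (such $\alpha$ exists and the value does not depend on its choice). A map $\psi:R\to\mathbb C^\times$ is a core-character if $\psi(\alpha+\beta)=\psi(\alpha)\psi(\beta)$ whenever $\alpha\in R^\times$, $\beta,\alpha+\beta\in R$; it is a character if $\psi(\alpha+\beta)=\psi(\alpha)\psi(\beta)$ whenever $\alpha,\beta,\alpha+\beta\in R$. *)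

theory Defs
  imports Complex_Main "HOL-Library.Function_Algebras"
begin

section \<open>Real and integral combinations of complex-valued functions\<close>

text \<open>
  A linear form on a subspace \<open>H\<close> of the type \<open>'a\<close> is represented by a function
  \<open>'a \<Rightarrow> complex\<close> that vanishes outside \<open>H\<close>. Such functions form a complex
  subspace of the space of all functions, so sums and differences of linear forms are the pointwise
  operations of \<^theory>\<open>HOL-Library.Function_Algebras\<close>. The real and the integral structure on
  this space are given by the following two scalar multiplications.
\<close>

definition rscale :: "real \<Rightarrow> ('a \<Rightarrow> complex) \<Rightarrow> 'a \<Rightarrow> complex"
  where "rscale r f = (\<lambda>x. of_real r * f x)"

definition zscale :: "int \<Rightarrow> ('a \<Rightarrow> complex) \<Rightarrow> 'a \<Rightarrow> complex"
  where "zscale n f = (\<lambda>x. of_int n * f x)"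

interpretation fun_real: vector_space rscale
  by unfold_locales (auto simp: rscale_def fun_eq_iff algebra_simps)

interpretation fun_int: module zscale
  by unfold_locales (auto simp: zscale_def fun_eq_iff algebra_simps)

section \<open>Simply laced Cartan matrices\<close>

datatype ade_type = Type_A nat | Type_D nat | Type_E nat

fun ade_rank :: "ade_type \<Rightarrow> nat" where
  "ade_rank (Type_A l) = l"
| "ade_rank (Type_D l) = l"
| "ade_rank (Type_E l) = l"

fun ade_valid :: "ade_type \<Rightarrow> bool" where
  "ade_valid (Type_A l) \<longleftrightarrow> 1 \<le> l"
| "ade_valid (Type_D l) \<longleftrightarrow> 4 \<le> l"
| "ade_valid (Type_E l) \<longleftrightarrow> l \<in> {6, 7, 8}"

text \<open>
  Nodes are numbered as in Bourbaki, but starting from \<open>0\<close>; each edge is listed in one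
  orientation only.
\<close>

fun dynkin_edges :: "ade_type \<Rightarrow> (nat \<times> nat) set" where
  "dynkin_edges (Type_A l) = {(i, i + 1) | i. i + 1 < l}"
| "dynkin_edges (Type_D l) = {(i, i + 1) | i. i + 2 < l} \<union> {(l - 3, l - 1)}"
| "dynkin_edges (Type_E l) = {(0, 2), (1, 3)} \<union> {(i, i + 1) | i. 2 \<le> i \<and> i + 1 < l}"

definition cartan_matrix :: "ade_type \<Rightarrow> nat \<Rightarrow> nat \<Rightarrow> int"
  where "cartan_matrix X i j =
    (if i = j then 2
     else if (i, j) \<in> dynkin_edges X \<or> (j, i) \<in> dynkin_edges X then - 1
     else 0)"

section \<open>Complex Lie algebras\<close>

locale lie_algebra = vector_space scale
  for scale :: "complex \<Rightarrow> 'a::ab_group_add \<Rightarrow> 'a" +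
  fixes bracket :: "'a \<Rightarrow> 'a \<Rightarrow> 'a"
  assumes bracket_linear_left: "Vector_Spaces.linear scale scale (\<lambda>x. bracket x y)"
    and bracket_linear_right: "Vector_Spaces.linear scale scale (\<lambda>y. bracket x y)"
    and bracket_self: "bracket x x = 0"
    and jacobi: "bracket x (bracket y z) + bracket y (bracket z x) + bracket z (bracket x y) = 0"
begin

definition subalgebra :: "'a set \<Rightarrow> bool"
  where "subalgebra S \<longleftrightarrow> subspace S \<and> (\<forall>x\<in>S. \<forall>y\<in>S. bracket x y \<in> S)"

definition generated_subalgebra :: "'a set \<Rightarrow> 'a set"
  where "generated_subalgebra X = \<Inter>{S. subalgebra S \<and> X \<subseteq> S}"

definition centralizer :: "'a set \<Rightarrow> 'a set"
  where "centralizer S = {x. \<forall>y\<in>S. bracket x y = 0}"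

definition ad_locally_nilpotent :: "'a \<Rightarrow> bool"
  where "ad_locally_nilpotent x \<longleftrightarrow> (\<forall>y. \<exists>n. (bracket x ^^ n) y = 0)"

definition automorphism :: "('a \<Rightarrow> 'a) \<Rightarrow> bool"
  where "automorphism \<Psi> \<longleftrightarrow> Vector_Spaces.linear scale scale \<Psi> \<and> bij \<Psi> \<and>
    (\<forall>x y. \<Psi> (bracket x y) = bracket (\<Psi> x) (\<Psi> y))"

end

section \<open>Roots with respect to a subspace\<close>

text \<open>
  This locale only fixes the data; the conditions on \<open>form\<close> and \<open>H\<close> are imposed in
  \<open>eala\<close> below.
\<close>

locale lie_datum = lie_algebra scale bracket
  for scale :: "complex \<Rightarrow> 'a::ab_group_add \<Rightarrow> 'a"
    and bracket :: "'a \<Rightarrow> 'a \<Rightarrow> 'a" +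
  fixes form :: "'a \<Rightarrow> 'a \<Rightarrow> complex"
    and H :: "'a set"
begin

definition dual :: "('a \<Rightarrow> complex) set"
  where "dual = {\<alpha>. (\<forall>x\<in>H. \<forall>y\<in>H. \<alpha> (x + y) = \<alpha> x + \<alpha> y) \<and>
    (\<forall>c. \<forall>x\<in>H. \<alpha> (scale c x) = c * \<alpha> x) \<and> (\<forall>x. x \<notin> H \<longrightarrow> \<alpha> x = 0)}"

definition root_space :: "('a \<Rightarrow> complex) \<Rightarrow> 'a set"
  where "root_space \<alpha> = {x. \<forall>h\<in>H. bracket h x = scale (\<alpha> h) x}"

definition roots :: "('a \<Rightarrow> complex) set"
  where "roots = {\<alpha> \<in> dual. root_space \<alpha> \<noteq> {0}}"

definition dual_vector :: "('a \<Rightarrow> complex) \<Rightarrow> 'a"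
  where "dual_vector \<alpha> = (THE t. t \<in> H \<and> (\<forall>h\<in>H. \<alpha> h = form h t))"

definition dual_form :: "('a \<Rightarrow> complex) \<Rightarrow> ('a \<Rightarrow> complex) \<Rightarrow> complex"
  where "dual_form \<alpha> \<beta> = form (dual_vector \<alpha>) (dual_vector \<beta>)"

definition isotropic_roots :: "('a \<Rightarrow> complex) set"
  where "isotropic_roots = {\<alpha> \<in> roots. dual_form \<alpha> \<alpha> = 0}"

definition nonisotropic_roots :: "('a \<Rightarrow> complex) set"
  where "nonisotropic_roots = roots - isotropic_roots"

definition core :: "'a set"
  where "core = generated_subalgebra (\<Union>\<alpha>\<in>nonisotropic_roots. root_space \<alpha>)"

definition root_real_span :: "('a \<Rightarrow> complex) set"
  where "root_real_span = fun_real.span roots"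

definition isotropic_real_span :: "('a \<Rightarrow> complex) set"
  where "isotropic_real_span = fun_real.span isotropic_roots"

text \<open>
  The image of a vector of \<open>root_real_span\<close> in the quotient by \<open>isotropic_real_span\<close>
  is its coset. The projection is linear, so a linear combination of cosets is
  the coset of the same linear combination of representatives; \<open>coset 0\<close> is the zero vector of
  the quotient.
\<close>

definition coset :: "('a \<Rightarrow> complex) \<Rightarrow> ('a \<Rightarrow> complex) set"
  where "coset \<alpha> = {\<beta>. \<beta> - \<alpha> \<in> isotropic_real_span}"

definition quotient_roots :: "('a \<Rightarrow> complex) set set"
  where "quotient_roots = coset ` roots"

text \<open>
  The rank is the dimension of the quotient space. For an extended affine Lie algebra both spaces
  are finite dimensional, since the integral span of the roots has finite rank.
\<close>

definition rank :: nat
  where "rank = fun_real.dim root_real_span - fun_real.dim isotropic_real_span"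

text \<open>
  The only multiples of a nonzero \<open>coset \<alpha>\<close> in the root system \<open>quotient_roots\<close>
  (which contains zero) are \<open>0\<close> and \<open>\<plusminus> coset \<alpha>\<close>.
\<close>

definition reduced_type :: bool
  where "reduced_type \<longleftrightarrow>
    (\<forall>\<alpha>\<in>roots. coset \<alpha> \<noteq> coset 0 \<longrightarrow>
      (\<forall>c::real. coset (rscale c \<alpha>) \<in> quotient_roots \<longrightarrow> c \<in> {- 1, 0, 1}))"

text \<open>
  The cosets of \<open>a 0, \<dots>, a (n - 1)\<close> are a base of the root system \<open>quotient_roots\<close>:
  they are linearly independent roots, and each root is an integral combination of them with
  coefficients of one sign.
\<close>

definition quotient_base :: "nat \<Rightarrow> (nat \<Rightarrow> 'a \<Rightarrow> complex) \<Rightarrow> bool"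
  where "quotient_base n a \<longleftrightarrow>
    (\<forall>i<n. a i \<in> roots) \<and>
    (\<forall>c::nat \<Rightarrow> real. coset (\<Sum>i<n. rscale (c i) (a i)) = coset 0 \<longrightarrow> (\<forall>i<n. c i = 0)) \<and>
    (\<forall>X\<in>quotient_roots. \<exists>k::nat \<Rightarrow> int. X = coset (\<Sum>i<n. zscale (k i) (a i)) \<and>
      ((\<forall>i<n. 0 \<le> k i) \<or> (\<forall>i<n. k i \<le> 0)))"

text \<open>
  The Cartan integers of \<open>quotient_roots\<close> may be computed from representatives, because
  \<open>isotropic_real_span\<close> is the radical of the form on \<open>root_real_span\<close> for an
  extended affine Lie algebra.
\<close>

definition has_type :: "ade_type \<Rightarrow> bool"
  where "has_type X \<longleftrightarrow> ade_valid X \<and>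
    (\<exists>a. quotient_base (ade_rank X) a \<and>
      (\<forall>i<ade_rank X. \<forall>j<ade_rank X.
        2 * dual_form (a i) (a j) / dual_form (a j) (a j) = of_int (cartan_matrix X i j)))"

definition simply_laced :: bool
  where "simply_laced \<longleftrightarrow> (\<exists>X. has_type X)"

definition cartan_automorphism :: "('a \<Rightarrow> 'a) \<Rightarrow> bool"
  where "cartan_automorphism \<Psi> \<longleftrightarrow> automorphism \<Psi> \<and> (\<forall>h\<in>H. \<Psi> h = h)"

definition diagonal :: "('a \<Rightarrow> 'a) \<Rightarrow> bool"
  where "diagonal \<Psi> \<longleftrightarrow> (\<forall>\<alpha>\<in>roots. \<exists>c. \<forall>x\<in>root_space \<alpha>. \<Psi> x = scale c x)"

definition eigenvalue :: "('a \<Rightarrow> 'a) \<Rightarrow> ('a \<Rightarrow> complex) \<Rightarrow> complex"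
  where "eigenvalue \<Psi> \<alpha> = (THE c. \<forall>x\<in>root_space \<alpha>. \<Psi> x = scale c x)"

text \<open>
  Only the values on \<open>roots\<close> are meaningful. For isotropic \<open>\<sigma>\<close> an admissible
  \<open>\<alpha>\<close> is chosen; for a finite order diagonal Cartan automorphism of an extended affine Lie
  algebra the result does not depend on this choice.
\<close>

definition core_character :: "('a \<Rightarrow> 'a) \<Rightarrow> ('a \<Rightarrow> complex) \<Rightarrow> complex"
  where "core_character \<Psi> \<sigma> =
    (if \<sigma> \<in> nonisotropic_roots then eigenvalue \<Psi> \<sigma>
     else (let \<alpha> = (SOME \<alpha>. \<alpha> \<in> nonisotropic_roots \<and> \<alpha> + \<sigma> \<in> nonisotropic_roots)
           in eigenvalue \<Psi> (\<alpha> + \<sigma>) * eigenvalue \<Psi> (- \<alpha>)))"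

definition is_character :: "(('a \<Rightarrow> complex) \<Rightarrow> complex) \<Rightarrow> bool"
  where "is_character \<psi> \<longleftrightarrow> (\<forall>\<alpha>\<in>roots. \<psi> \<alpha> \<noteq> 0) \<and>
    (\<forall>\<alpha>\<in>roots. \<forall>\<beta>\<in>roots. \<alpha> + \<beta> \<in> roots \<longrightarrow> \<psi> (\<alpha> + \<beta>) = \<psi> \<alpha> * \<psi> \<beta>)"

end

definition finite_order :: "('a \<Rightarrow> 'a) \<Rightarrow> bool"
  where "finite_order f \<longleftrightarrow> (\<exists>n>0. f ^^ n = id)"

section \<open>Extended affine Lie algebras\<close>

locale eala = lie_datum scale bracket form H
  for scale :: "complex \<Rightarrow> 'a::ab_group_add \<Rightarrow> 'a"
    and bracket :: "'a \<Rightarrow> 'a \<Rightarrow> 'a"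
    and form :: "'a \<Rightarrow> 'a \<Rightarrow> complex"
    and H :: "'a set" +
  assumes H_subalgebra: "subalgebra H"
    and H_nontrivial: "H \<noteq> {0}"
    and H_finite_dim: "\<exists>B. finite B \<and> span B = H"
    and form_linear: "Vector_Spaces.linear scale (*) (form x)"
    and form_symmetric: "form x y = form y x"
    and form_invariant: "form (bracket x y) z = form x (bracket y z)"
    and form_nondegenerate: "(\<And>y. form x y = 0) \<Longrightarrow> x = 0"
    and root_space_sum: "span (\<Union>\<alpha>\<in>roots. root_space \<alpha>) = UNIV"
    and root_space_zero: "root_space 0 = H"
    and locally_nilpotent: "\<alpha> \<in> nonisotropic_roots \<Longrightarrow> x \<in> root_space \<alpha> \<Longrightarrow> ad_locally_nilpotent x"
    and tame: "centralizer core \<subseteq> core"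
    and lattice: "\<exists>B. finite B \<and> fun_int.independent B \<and> fun_int.span B = fun_int.span roots"
    and irreducible: "nonisotropic_roots = R1 \<union> R2 \<Longrightarrow> R1 \<inter> R2 = {} \<Longrightarrow> R1 \<noteq> {} \<Longrightarrow> R2 \<noteq> {} \<Longrightarrow>
      \<exists>\<alpha>\<in>R1. \<exists>\<beta>\<in>R2. dual_form \<alpha> \<beta> \<noteq> 0"

end

theory Submission
  imports Defs
begin

text \<open>
  The roots of nonzero length behave as in a finite simply laced root system, and everything about
  the isotropic root spaces is derived from the nonisotropic ones by translation and tameness.

  For a nonisotropic root \<open>\<alpha>\<close> there is an \<open>sl2\<close>-triple in \<open>E\<^sub>\<alpha> \<oplus> H \<oplus> E\<^sub>-\<^sub>\<alpha>\<close>, and local nilpotency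
  gives integral Cartan numbers, reflections and nonzero brackets. In particular \<open>E\<^sub>\<alpha>\<close> is a line, so
  \<open>\<Psi>\<close> acts on it by a scalar \<open>\<eta>\<^sub>\<alpha>\<close>. A Heisenberg algebra argument shows that isotropic roots are
  orthogonal to all roots (\<open>isotropic_orthogonal\<close>). Because the Cartan matrix is positive
  semidefinite and the type is reduced, all nonisotropic roots have the same length
  (\<open>nonisotropic_length\<close>), so their Cartan numbers lie between \<open>-2\<close> and \<open>2\<close>, with \<open>\<plusminus>2\<close>
  only for roots that agree up to sign and an isotropic root. If \<open>\<alpha>\<close>, \<open>\<beta>\<close> and \<open>\<alpha> + \<beta>\<close> are
  nonisotropic then \<open>[E\<^sub>\<alpha>, E\<^sub>\<beta>] \<noteq> 0\<close>, whence \<open>\<eta>\<^sub>\<alpha>\<^sub>+\<^sub>\<beta> = \<eta>\<^sub>\<alpha> \<eta>\<^sub>\<beta>\<close>.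

  Let \<open>\<sigma>\<close> be isotropic and \<open>\<alpha> + \<sigma>\<close> a root for one nonisotropic \<open>\<alpha>\<close>. Moving along pairs of
  non-orthogonal roots, which is possible by irreducibility and because the rank exceeds one, shows
  that \<open>\<beta> + \<sigma>\<close> is a root for every nonisotropic \<open>\<beta>\<close> and that the ratio \<open>\<eta>\<^sub>\<beta>\<^sub>+\<^sub>\<sigma> / \<eta>\<^sub>\<beta>\<close> does not
  depend on \<open>\<beta>\<close> (\<open>isotropic_shift_constant\<close>). This ratio is the value \<open>\<psi>(\<sigma>)\<close> of the core-character,
  and its independence of \<open>\<beta>\<close> makes \<open>\<psi>\<close> multiplicative, also on sums of two isotropic roots
  (\<open>core_character_add\<close>). Hence \<open>\<Psi>\<close> acts by \<open>\<psi>\<close> on the graded pieces of the core.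

  Outside the core, for \<open>x \<in> E\<^sub>\<sigma>\<close> the vector \<open>z = \<Psi> x - \<psi>(\<sigma>) x\<close> commutes with all nonisotropic
  root spaces, so by tameness it lies in the core and satisfies \<open>\<Psi> z = \<psi>(\<sigma>) z\<close>. An automorphism of
  finite order has no nontrivial Jordan block, so \<open>z = 0\<close> (\<open>aut_isotropic\<close>).
\<close>

section \<open>Operators in a Lie algebra\<close>

context lie_algebra
begin

lemma bracket_add_left: "bracket (x + y) z = bracket x z + bracket y z"
  using module_hom.add[of scale scale "\<lambda>x. bracket x z" x y] bracket_linear_left[of z]
  by (simp add: Vector_Spaces.linear_def)

lemma bracket_add_right: "bracket z (x + y) = bracket z x + bracket z y"
  using module_hom.add[of scale scale "bracket z" x y] bracket_linear_right[of z]
  by (simp add: Vector_Spaces.linear_def)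

lemma bracket_scale_left: "bracket (scale c x) z = scale c (bracket x z)"
  using module_hom.scale[of scale scale "\<lambda>x. bracket x z" c x] bracket_linear_left[of z]
  by (simp add: Vector_Spaces.linear_def)

lemma bracket_scale_right: "bracket z (scale c x) = scale c (bracket z x)"
  using module_hom.scale[of scale scale "bracket z" c x] bracket_linear_right[of z]
  by (simp add: Vector_Spaces.linear_def)

lemma bracket_zero_left [simp]: "bracket 0 z = 0"
  using bracket_add_left[of 0 0 z] by simp

lemma bracket_zero_right [simp]: "bracket z 0 = 0"
  using bracket_add_right[of z 0 0] by simp

lemma bracket_minus_left: "bracket (- x) z = - bracket x z"
  using bracket_add_left[of x "- x" z] by (simp add: eq_neg_iff_add_eq_0 add.commute)

lemma bracket_minus_right: "bracket z (- x) = - bracket z x"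
  using bracket_add_right[of z x "- x"] by (simp add: eq_neg_iff_add_eq_0 add.commute)

lemma bracket_diff_left: "bracket (x - y) z = bracket x z - bracket y z"
  using bracket_add_left[of x "- y" z] by (simp add: bracket_minus_left)

lemma bracket_swap: "bracket x y = - bracket y x"
proof -
  have "0 = bracket (x + y) (x + y)" by (simp only: bracket_self)
  also have "\<dots> = bracket x y + bracket y x"
    unfolding bracket_add_left bracket_add_right by (simp add: bracket_self)
  finally show ?thesis by (simp add: eq_neg_iff_add_eq_0)
qed

lemma bracket_derivation:
  "bracket x (bracket y z) = bracket (bracket x y) z + bracket y (bracket x z)"
proof -
  have "bracket x (bracket y z) = - bracket y (bracket z x) - bracket z (bracket x y)"
    using jacobi[of x y z] by (metis add_diff_cancel_right' diff_0 diff_diff_add minus_diff_commute)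
  also have "bracket y (bracket z x) = - bracket y (bracket x z)"
    by (subst bracket_swap[of z x]) (rule bracket_minus_right)
  also have "bracket z (bracket x y) = - bracket (bracket x y) z" by (rule bracket_swap)
  finally show ?thesis by simp
qed

lemma ad_power_zero [simp]: "(bracket y ^^ n) 0 = 0"
  by (induction n) auto

lemma ad_power_weight:
  assumes "bracket t y = scale c y" and "bracket t z = scale m z"
  shows "bracket t ((bracket y ^^ n) z) = scale (m + of_nat n * c) ((bracket y ^^ n) z)"
proof (induction n)
  case 0
  then show ?case using assms by simp
next
  case (Suc n)
  have "bracket t (bracket y ((bracket y ^^ n) z)) =
      scale c (bracket y ((bracket y ^^ n) z))
      + bracket y (scale (m + of_nat n * c) ((bracket y ^^ n) z))"
    by (subst bracket_derivation) (simp add: assms Suc bracket_scale_left)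
  then show ?case
    by (simp add: bracket_scale_right flip: scale_left_distrib) (simp add: algebra_simps)
qed

text \<open>
  This is the one computation behind the representation theory used below. With \<open>s = 2\<close> it is the
  action of the raising operator in an \<open>sl2\<close>-module, with \<open>s = 0\<close> it is the canonical commutation
  relation of a Heisenberg algebra.
\<close>

lemma ad_power_commutation:
  assumes "bracket x y = t" and "bracket t y = scale (- s) y" and "bracket t z = scale m z"
  shows "bracket x ((bracket y ^^ Suc n) z) = (bracket y ^^ Suc n) (bracket x z)
    + scale (of_nat (Suc n) * (m - s * of_nat n / 2)) ((bracket y ^^ n) z)"
proof (induction n)
  case 0
  show ?case using bracket_derivation[of x y z] assms by (simp add: add.commute)
next
  case (Suc n)
  let ?z = "(bracket y ^^ Suc n) z"
  let ?c = "of_nat (Suc n) * (m - s * of_nat n / 2)"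
  have c: "m + of_nat (Suc n) * (- s) + ?c
      = of_nat (Suc (Suc n)) * (m - s * of_nat (Suc n) / 2)"
    by (simp add: field_simps)
  have "bracket x (bracket y ?z) = bracket t ?z + bracket y (bracket x ?z)"
    by (subst bracket_derivation) (simp add: assms)
  also have "bracket t ?z = scale (m + of_nat (Suc n) * (- s)) ?z"
    by (rule ad_power_weight[OF assms(2,3)])
  also have "bracket y (bracket x ?z) = (bracket y ^^ Suc (Suc n)) (bracket x z) + scale ?c ?z"
    unfolding Suc by (simp add: bracket_add_right bracket_scale_right)
  finally have "bracket x (bracket y ?z) = (bracket y ^^ Suc (Suc n)) (bracket x z)
      + scale (m + of_nat (Suc n) * (- s) + ?c) ?z"
    by (simp only: scale_left_distrib add_ac)
  then show ?case unfolding c by simp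
qed

lemma ad_power_primitive_nonzero:
  assumes "bracket x y = t" and "bracket t y = scale (- s) y" and "bracket t w = scale m w"
    and "bracket x w = 0" and "w \<noteq> 0" and "\<And>j. j < n \<Longrightarrow> m \<noteq> s * of_nat j / 2"
  shows "(bracket y ^^ n) w \<noteq> 0"
  using assms(6)
proof (induction n)
  case 0
  then show ?case using assms(5) by simp
next
  case (Suc n)
  have nz: "(bracket y ^^ n) w \<noteq> 0" using Suc by simp
  show ?case
  proof
    assume "(bracket y ^^ Suc n) w = 0"
    then have "scale (of_nat (Suc n) * (m - s * of_nat n / 2)) ((bracket y ^^ n) w) = 0"
      using ad_power_commutation[OF assms(1-3), of n] assms(4) by (simp del: of_nat_Suc)
    then show False using nz Suc.prems[of n] by (simp del: of_nat_Suc)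
  qed
qed

lemma last_nonzero_ad_power:
  assumes "(bracket x ^^ n) z = 0" and "z \<noteq> 0"
  obtains k where "(bracket x ^^ k) z \<noteq> 0" and "bracket x ((bracket x ^^ k) z) = 0"
proof -
  define k where "k = (LEAST n. (bracket x ^^ n) z = 0)"
  have k0: "(bracket x ^^ k) z = 0" unfolding k_def using assms(1) by (rule LeastI)
  then obtain j where j: "k = Suc j" using assms(2) by (cases k) auto
  have "(bracket x ^^ j) z \<noteq> 0"
    using not_less_Least[of j "\<lambda>n. (bracket x ^^ n) z = 0"] j unfolding k_def by auto
  with k0 j that show thesis by auto
qed

text \<open>
  If a power of \<open>x\<close> kills \<open>z\<close>, the last nonzero vector among the \<open>x\<^sup>k z\<close> is a vacuum vector, and
  \<open>y\<close> generates infinitely many nonzero vectors from it because the central element \<open>t\<close> acts by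
  \<open>c \<noteq> 0\<close>.
\<close>

lemma heisenberg_unbounded:
  assumes "bracket x y = t" and "bracket t x = 0" and "bracket t y = 0"
    and "bracket t z = scale c z" and "c \<noteq> 0" and "z \<noteq> 0"
  shows "(\<forall>n. (bracket x ^^ n) z \<noteq> 0) \<or>
    (\<exists>k. \<forall>n. (bracket y ^^ n) ((bracket x ^^ k) z) \<noteq> 0)"
proof (cases "\<forall>n. (bracket x ^^ n) z \<noteq> 0")
  case True
  then show ?thesis by blast
next
  case False
  then obtain k where k: "(bracket x ^^ k) z \<noteq> 0" "bracket x ((bracket x ^^ k) z) = 0"
    using last_nonzero_ad_power assms(6) by metis
  have "bracket t ((bracket x ^^ k) z) = scale c ((bracket x ^^ k) z)"
    using ad_power_weight[of t x 0 z c k] assms(2,4) by simp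
  then have "(bracket y ^^ n) ((bracket x ^^ k) z) \<noteq> 0" for n
    using ad_power_primitive_nonzero[OF assms(1), of 0 "(bracket x ^^ k) z" c n] k assms(3,5)
    by simp
  then show ?thesis by blast
qed

definition sl2_triple :: "'a \<Rightarrow> 'a \<Rightarrow> 'a \<Rightarrow> bool"
  where "sl2_triple e h f \<longleftrightarrow>
    bracket e f = h \<and> bracket h e = scale 2 e \<and> bracket h f = scale (- 2) f"

lemma sl2_primitive_weight:
  assumes "sl2_triple e h f" and "ad_locally_nilpotent f"
    and "bracket h w = scale m w" and "bracket e w = 0" and "w \<noteq> 0"
  shows "\<exists>j::nat. m = of_nat j"
proof (rule ccontr)
  assume "\<not> ?thesis"
  then have "(bracket f ^^ n) w \<noteq> 0" for n
    using assms ad_power_primitive_nonzero[of e f h 2 w m n] by (simp add: sl2_triple_def)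
  with assms(2) show False unfolding ad_locally_nilpotent_def by blast
qed

text \<open>
  A primitive vector \<open>(ad e)\<^sup>k z\<close> has weight \<open>m + 2 k\<close>, which is a natural number.
\<close>

lemma sl2_weight_integral:
  assumes "sl2_triple e h f" and "ad_locally_nilpotent e" and "ad_locally_nilpotent f"
    and "bracket h z = scale m z" and "z \<noteq> 0"
  shows "\<exists>p::int. m = of_int p"
proof -
  obtain n where "(bracket e ^^ n) z = 0" using assms(2) by (auto simp: ad_locally_nilpotent_def)
  then obtain k where k: "(bracket e ^^ k) z \<noteq> 0" "bracket e ((bracket e ^^ k) z) = 0"
    using last_nonzero_ad_power assms(5) by metis
  have "bracket h ((bracket e ^^ k) z) = scale (m + of_nat k * 2) ((bracket e ^^ k) z)"
    using assms(1,4) by (intro ad_power_weight) (simp_all add: sl2_triple_def)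
  then obtain j :: nat where "m + of_nat k * 2 = of_nat j"
    using sl2_primitive_weight[OF assms(1,3)] k by blast
  then have "m = of_int (int j - 2 * int k)" by (simp add: algebra_simps)
  then show ?thesis by blast
qed

text \<open>
  Weights are symmetric under the reflection \<open>m \<mapsto> - m\<close>. If \<open>f\<^sup>m\<close> kills \<open>z\<close> of weight \<open>m\<close>, then
  \<open>f\<^sup>m\<^sup>+\<^sup>2\<close> kills the vector \<open>[e, z]\<close> of weight \<open>m + 2\<close>, so an induction on the nilpotency of \<open>e\<close>
  at \<open>z\<close> reduces the claim to primitive vectors.
\<close>

lemma sl2_lowering_injective:
  assumes "sl2_triple e h f"
  shows "\<lbrakk>(bracket e ^^ k) z = 0; bracket h z = scale (of_nat m) z; (bracket f ^^ m) z = 0\<rbrakk> \<Longrightarrow> z = 0"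
proof (induction k arbitrary: z m)
  case 0
  then show ?case by simp
next
  case (Suc k)
  have t: "bracket e f = h" "bracket h e = scale 2 e" "bracket h f = scale (- 2) f"
    using assms by (auto simp: sl2_triple_def)
  have f1: "(bracket f ^^ Suc m) z = 0" using Suc.prems(3) by simp
  have f2: "(bracket f ^^ Suc (Suc m)) z = 0" using f1 by simp
  have "(bracket f ^^ Suc (Suc m)) (bracket e z) = 0"
    using ad_power_commutation[OF t(1,3) Suc.prems(2), of "Suc m"]
    unfolding f1 f2 by simp
  moreover have "bracket h (bracket e z) = scale (of_nat (Suc (Suc m))) (bracket e z)"
    using ad_power_weight[OF t(2) Suc.prems(2), of 1] by (simp add: add.commute)
  moreover have "(bracket e ^^ k) (bracket e z) = 0"
    using Suc.prems(1) by (simp add: funpow_swap1)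
  ultimately have "bracket e z = 0" using Suc.IH by blast
  moreover have "(of_nat m :: complex) \<noteq> 2 * of_nat j / 2" if "j < m" for j
    using that by simp
  ultimately show ?case
    using ad_power_primitive_nonzero[OF t(1,3) Suc.prems(2)] Suc.prems(3) by blast
qed

end

section \<open>Root spaces and the form\<close>

context eala
begin

lemma form_add_right: "form z (x + y) = form z x + form z y"
  using module_hom.add[of scale "(*)" "form z" x y] form_linear[of z]
  by (simp add: Vector_Spaces.linear_def)

lemma form_scale_right: "form z (scale c x) = c * form z x"
  using module_hom.scale[of scale "(*)" "form z" c x] form_linear[of z]
  by (simp add: Vector_Spaces.linear_def)

lemma form_add_left: "form (x + y) z = form x z + form y z"
  using form_add_right form_symmetric by metis

lemma form_scale_left: "form (scale c x) z = c * form x z"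
  using form_scale_right form_symmetric by metis

lemma form_zero_right [simp]: "form z 0 = 0"
  using form_scale_right[of z 0 0] by simp

lemma form_zero_left [simp]: "form 0 z = 0"
  using form_symmetric[of 0 z] by simp

lemma form_diff_left: "form (x - y) z = form x z - form y z"
  using form_add_left[of "x - y" y z] by simp

lemma form_diff_right: "form z (x - y) = form z x - form z y"
  using form_add_right[of z "x - y" y] by simp

lemma H_subspace: "subspace H"
  using H_subalgebra by (simp add: subalgebra_def)

lemma zero_in_H: "0 \<in> H"
  using H_subspace by (rule subspace_0)

lemma root_spaceI: "(\<And>h. h \<in> H \<Longrightarrow> bracket h x = scale (\<alpha> h) x) \<Longrightarrow> x \<in> root_space \<alpha>"
  by (simp add: root_space_def)

lemma root_spaceD: "x \<in> root_space \<alpha> \<Longrightarrow> h \<in> H \<Longrightarrow> bracket h x = scale (\<alpha> h) x"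
  by (simp add: root_space_def)

lemma root_space_subspace: "subspace (root_space \<alpha>)"
  unfolding subspace_def root_space_def
  by (auto simp: bracket_add_right bracket_scale_right scale_right_distrib mult.commute)

lemma zero_in_root_space [simp]: "0 \<in> root_space \<alpha>"
  using root_space_subspace by (rule subspace_0)

lemma root_space_bracket:
  assumes "x \<in> root_space \<alpha>" and "y \<in> root_space \<beta>"
  shows "bracket x y \<in> root_space (\<alpha> + \<beta>)"
proof (rule root_spaceI)
  fix h assume h: "h \<in> H"
  show "bracket h (bracket x y) = scale ((\<alpha> + \<beta>) h) (bracket x y)"
    by (subst bracket_derivation)
      (simp add: root_spaceD[OF assms(1) h] root_spaceD[OF assms(2) h] bracket_scale_left bracket_scale_right
        scale_left_distrib)
qed

lemma dual_add: "\<alpha> \<in> dual \<Longrightarrow> \<beta> \<in> dual \<Longrightarrow> \<alpha> + \<beta> \<in> dual"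
  by (auto simp: dual_def algebra_simps)

lemma dual_uminus: "\<alpha> \<in> dual \<Longrightarrow> - \<alpha> \<in> dual"
  by (auto simp: dual_def)

lemma zero_dual: "0 \<in> dual"
  by (auto simp: dual_def)

lemma roots_dual: "\<alpha> \<in> roots \<Longrightarrow> \<alpha> \<in> dual"
  by (simp add: roots_def)

lemma rootI: "\<alpha> \<in> dual \<Longrightarrow> x \<in> root_space \<alpha> \<Longrightarrow> x \<noteq> 0 \<Longrightarrow> \<alpha> \<in> roots"
  by (auto simp: roots_def)

lemma root_space_nonzero:
  assumes "\<alpha> \<in> roots"
  obtains x where "x \<in> root_space \<alpha>" and "x \<noteq> 0"
  using assms zero_in_root_space[of \<alpha>] by (auto simp: roots_def)

lemma form_orthogonal:
  assumes "\<alpha> \<in> dual" and "\<beta> \<in> dual" and "\<alpha> + \<beta> \<noteq> 0"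
    and "x \<in> root_space \<alpha>" and "y \<in> root_space \<beta>"
  shows "form x y = 0"
proof -
  obtain h where h: "\<alpha> h + \<beta> h \<noteq> 0" using assms(3) by (auto simp: fun_eq_iff)
  have "\<alpha> h = 0 \<and> \<beta> h = 0" if "h \<notin> H" using assms(1,2) that by (simp add: dual_def)
  with h have hH: "h \<in> H" by (cases "h \<in> H") auto
  have "\<alpha> h * form x y = form (bracket h x) y"
    by (simp add: root_spaceD[OF assms(4) hH] form_scale_left)
  also have "\<dots> = - form (bracket x h) y"
    by (subst bracket_swap) (metis add.inverse_inverse bracket_minus_left form_diff_left
        form_zero_left diff_0 minus_diff_eq)
  also have "\<dots> = - (\<beta> h * form x y)"
    by (simp add: form_invariant root_spaceD[OF assms(5) hH] form_scale_right)
  finally have "(\<alpha> h + \<beta> h) * form x y = 0" by (simp add: algebra_simps)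
  with h show ?thesis by simp
qed

text \<open>
  Different root spaces are orthogonal unless the roots are opposite, so nondegeneracy on the whole
  algebra is nondegeneracy of each pairing of opposite root spaces.
\<close>

lemma form_pairing_nonzero:
  assumes "\<alpha> \<in> dual" and "x \<in> root_space \<alpha>" and "x \<noteq> 0"
  obtains y where "y \<in> root_space (- \<alpha>)" and "form x y \<noteq> 0"
proof -
  have "\<exists>\<beta>\<in>roots. \<exists>y\<in>root_space \<beta>. form x y \<noteq> 0"
  proof (rule ccontr)
    assume *: "\<not> ?thesis"
    have "form x y = 0" for y
    proof -
      have "y \<in> span (\<Union>\<alpha>\<in>roots. root_space \<alpha>)" using root_space_sum by simp
      then show ?thesis
        by (induction rule: span_induct_alt) (use * in \<open>auto simp: form_add_right form_scale_right\<close>)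
    qed
    with form_nondegenerate assms(3) show False by blast
  qed
  then obtain \<beta> y where b: "\<beta> \<in> roots" "y \<in> root_space \<beta>" "form x y \<noteq> 0" by blast
  then have "\<alpha> + \<beta> = 0" using form_orthogonal assms roots_dual by blast
  then have "\<beta> = - \<alpha>" by (simp add: eq_neg_iff_add_eq_0 add.commute)
  with b that show thesis by blast
qed

lemma uminus_root:
  assumes "\<alpha> \<in> roots"
  shows "- \<alpha> \<in> roots"
  using root_space_nonzero[OF assms] form_pairing_nonzero[OF roots_dual[OF assms]]
    rootI[OF dual_uminus[OF roots_dual[OF assms]]] form_zero_right by metis

lemma H_nondegenerate:
  assumes "t \<in> H" and "\<And>h. h \<in> H \<Longrightarrow> form h t = 0"
  shows "t = 0"
  using form_pairing_nonzero[OF zero_dual, of t] assms root_space_zero form_symmetric[of t]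
  by auto

text \<open>
  For a root \<open>\<alpha>\<close> the vector \<open>t\<^sub>\<alpha>\<close> is found as a multiple of a bracket \<open>[x, y]\<close> with \<open>x\<close> and \<open>y\<close>
  in opposite root spaces. The functionals of the form \<open>form _ t\<close> are closed under real
  combinations, and on them \<open>dual_form\<close> is bilinear.
\<close>

definition represents :: "'a \<Rightarrow> ('a \<Rightarrow> complex) \<Rightarrow> bool"
  where "represents t \<alpha> \<longleftrightarrow> \<alpha> \<in> dual \<and> t \<in> H \<and> (\<forall>h\<in>H. \<alpha> h = form h t)"

definition representable :: "('a \<Rightarrow> complex) set"
  where "representable = {\<alpha>. \<exists>t. represents t \<alpha>}"

lemma represents_unique:
  assumes "represents s \<alpha>" and "represents t \<alpha>"
  shows "s = t"
proof -
  have "s - t \<in> H" using assms H_subspace subspace_diff by (auto simp: represents_def)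
  moreover have "form h (s - t) = 0" if "h \<in> H" for h
    using assms that by (simp add: represents_def form_diff_right)
  ultimately have "s - t = 0" by (rule H_nondegenerate)
  then show ?thesis by simp
qed

lemma dual_vector_eq:
  assumes "represents t \<alpha>"
  shows "dual_vector \<alpha> = t"
  unfolding dual_vector_def
proof (rule the_equality)
  show "t \<in> H \<and> (\<forall>h\<in>H. \<alpha> h = form h t)" using assms by (simp add: represents_def)
  show "s = t" if "s \<in> H \<and> (\<forall>h\<in>H. \<alpha> h = form h s)" for s
    using represents_unique[OF _ assms] that assms by (simp add: represents_def)
qed

lemma represents_dual_vector: "\<alpha> \<in> representable \<Longrightarrow> represents (dual_vector \<alpha>) \<alpha>"
  using dual_vector_eq by (auto simp: representable_def)

lemma dual_form_eq_right:
  "\<alpha> \<in> representable \<Longrightarrow> \<beta> \<in> representable \<Longrightarrow> dual_form \<alpha> \<beta> = \<beta> (dual_vector \<alpha>)"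
  using represents_dual_vector by (simp add: dual_form_def represents_def)

lemma dual_form_sym: "dual_form \<alpha> \<beta> = dual_form \<beta> \<alpha>"
  unfolding dual_form_def by (rule form_symmetric)

lemma representable_subspace: "fun_real.subspace representable"
proof -
  have "represents 0 0" using zero_in_H zero_dual by (simp add: represents_def)
  moreover have "represents (s + t) (\<alpha> + \<beta>)" if "represents s \<alpha>" "represents t \<beta>" for s t \<alpha> \<beta>
    using that subspace_add[OF H_subspace] dual_add
    by (simp add: represents_def form_add_right)
  moreover have "represents (scale (of_real r) t) (rscale r \<alpha>)" if "represents t \<alpha>" for r t \<alpha>
    using that subspace_scale[OF H_subspace]
    by (auto simp: represents_def rscale_def form_scale_right dual_def algebra_simps)
  ultimately show ?thesis unfolding fun_real.subspace_def representable_def by blast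
qed

lemma dual_form_add_right:
  "\<lbrakk>\<alpha> \<in> representable; \<beta> \<in> representable; \<gamma> \<in> representable\<rbrakk>
    \<Longrightarrow> dual_form \<alpha> (\<beta> + \<gamma>) = dual_form \<alpha> \<beta> + dual_form \<alpha> \<gamma>"
  using fun_real.subspace_add[OF representable_subspace, of \<beta> \<gamma>]
  by (simp add: dual_form_eq_right)

lemma dual_form_rscale_right:
  "\<lbrakk>\<alpha> \<in> representable; \<beta> \<in> representable\<rbrakk>
    \<Longrightarrow> dual_form \<alpha> (rscale r \<beta>) = of_real r * dual_form \<alpha> \<beta>"
  using fun_real.subspace_scale[OF representable_subspace, of \<beta> r]
  by (simp add: dual_form_eq_right) (simp add: rscale_def)

lemma represents_bracket:
  assumes "\<alpha> \<in> dual" and "x \<in> root_space \<alpha>" and "y \<in> root_space (- \<alpha>)" and "form x y \<noteq> 0"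
  shows "represents (scale (1 / form x y) (bracket x y)) \<alpha>"
proof -
  have "bracket x y \<in> H" using root_space_bracket[OF assms(2,3)] root_space_zero by simp
  moreover have "form h (bracket x y) = \<alpha> h * form x y" if "h \<in> H" for h
    using root_spaceD[OF assms(2) that] by (simp flip: form_invariant) (simp add: form_scale_left)
  ultimately show ?thesis using assms subspace_scale[OF H_subspace]
    by (simp add: represents_def form_scale_right)
qed

lemma roots_representable: "roots \<subseteq> representable"
proof
  fix \<alpha> assume a: "\<alpha> \<in> roots"
  then obtain x where x: "x \<in> root_space \<alpha>" "x \<noteq> 0" using root_space_nonzero by blast
  then obtain y where "y \<in> root_space (- \<alpha>)" "form x y \<noteq> 0"
    using form_pairing_nonzero roots_dual a by blast
  then show "\<alpha> \<in> representable"
    using represents_bracket x a roots_dual unfolding representable_def by blast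
qed

lemma root_representable: "\<alpha> \<in> roots \<Longrightarrow> \<alpha> \<in> representable"
  using roots_representable by blast

lemma bracket_opposite:
  assumes "\<alpha> \<in> roots" and "x \<in> root_space \<alpha>" and "y \<in> root_space (- \<alpha>)"
  shows "bracket x y = scale (form x y) (dual_vector \<alpha>)"
proof -
  have t: "represents (dual_vector \<alpha>) \<alpha>"
    using represents_dual_vector roots_representable assms(1) by blast
  let ?d = "bracket x y - scale (form x y) (dual_vector \<alpha>)"
  have "bracket x y \<in> H" using root_space_bracket[OF assms(2,3)] root_space_zero by simp
  then have "?d \<in> H"
    using t subspace_diff[OF H_subspace] subspace_scale[OF H_subspace] by (simp add: represents_def)
  moreover have "form h ?d = 0" if "h \<in> H" for h
  proof -
    have "form h (bracket x y) = \<alpha> h * form x y"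
      using root_spaceD[OF assms(2) that] by (simp flip: form_invariant) (simp add: form_scale_left)
    moreover have "\<alpha> h = form h (dual_vector \<alpha>)" using t that by (simp add: represents_def)
    ultimately show ?thesis
      by (simp add: form_symmetric[of h] form_diff_left form_scale_left)
  qed
  ultimately have "?d = 0" by (rule H_nondegenerate)
  then show ?thesis by simp
qed

lemma bracket_dual_vector:
  assumes "\<alpha> \<in> representable" and "\<beta> \<in> representable" and "z \<in> root_space \<beta>"
  shows "bracket (dual_vector \<alpha>) z = scale (dual_form \<alpha> \<beta>) z"
  using represents_dual_vector[OF assms(1)] root_spaceD[OF assms(3)]
    dual_form_eq_right[OF assms(1,2)] by (simp add: represents_def)

lemma representable_add:
  "\<alpha> \<in> representable \<Longrightarrow> \<beta> \<in> representable \<Longrightarrow> \<alpha> + \<beta> \<in> representable"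
  using fun_real.subspace_add[OF representable_subspace] .

lemma representable_rscale: "\<alpha> \<in> representable \<Longrightarrow> rscale r \<alpha> \<in> representable"
  using fun_real.subspace_scale[OF representable_subspace] .

lemma representable_uminus: "\<alpha> \<in> representable \<Longrightarrow> - \<alpha> \<in> representable"
  using fun_real.subspace_neg[OF representable_subspace] .

lemma dual_form_uminus_right:
  "\<lbrakk>\<alpha> \<in> representable; \<beta> \<in> representable\<rbrakk> \<Longrightarrow> dual_form \<alpha> (- \<beta>) = - dual_form \<alpha> \<beta>"
  using dual_form_rscale_right[of \<alpha> \<beta> "- 1"] by simp

lemma dual_form_add_left:
  "\<lbrakk>\<alpha> \<in> representable; \<beta> \<in> representable; \<gamma> \<in> representable\<rbrakk>
    \<Longrightarrow> dual_form (\<alpha> + \<beta>) \<gamma> = dual_form \<alpha> \<gamma> + dual_form \<beta> \<gamma>"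
  using dual_form_add_right[of \<gamma> \<alpha> \<beta>] by (simp add: dual_form_sym)

lemma dual_form_uminus_left:
  "\<lbrakk>\<alpha> \<in> representable; \<beta> \<in> representable\<rbrakk> \<Longrightarrow> dual_form (- \<alpha>) \<beta> = - dual_form \<alpha> \<beta>"
  using dual_form_uminus_right[of \<beta> \<alpha>] by (simp add: dual_form_sym)

lemma dual_form_rscale_left:
  "\<lbrakk>\<alpha> \<in> representable; \<beta> \<in> representable\<rbrakk>
    \<Longrightarrow> dual_form (rscale r \<alpha>) \<beta> = of_real r * dual_form \<alpha> \<beta>"
  using dual_form_rscale_right[of \<beta> \<alpha> r] by (simp add: dual_form_sym)

lemmas dual_form_simps = root_representable representable_add representable_rscale
  representable_uminus dual_form_add_left dual_form_add_right dual_form_uminus_left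
  dual_form_uminus_right dual_form_rscale_left dual_form_rscale_right

section \<open>Root strings\<close>

lemma nonisotropic_iff: "\<alpha> \<in> nonisotropic_roots \<longleftrightarrow> \<alpha> \<in> roots \<and> dual_form \<alpha> \<alpha> \<noteq> 0"
  by (auto simp: nonisotropic_roots_def isotropic_roots_def)

lemma isotropic_iff: "\<alpha> \<in> isotropic_roots \<longleftrightarrow> \<alpha> \<in> roots \<and> dual_form \<alpha> \<alpha> = 0"
  by (auto simp: isotropic_roots_def)

lemma nonisotropic_root: "\<alpha> \<in> nonisotropic_roots \<Longrightarrow> \<alpha> \<in> roots"
  by (simp add: nonisotropic_iff)

lemma uminus_nonisotropic: "\<alpha> \<in> nonisotropic_roots \<Longrightarrow> - \<alpha> \<in> nonisotropic_roots"
  by (simp add: nonisotropic_iff uminus_root dual_form_simps)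

lemma uminus_isotropic: "\<alpha> \<in> isotropic_roots \<Longrightarrow> - \<alpha> \<in> isotropic_roots"
  by (simp add: isotropic_iff uminus_root dual_form_simps)

definition coroot :: "('a \<Rightarrow> complex) \<Rightarrow> 'a"
  where "coroot \<alpha> = scale (2 / dual_form \<alpha> \<alpha>) (dual_vector \<alpha>)"

definition cartan_number :: "('a \<Rightarrow> complex) \<Rightarrow> ('a \<Rightarrow> complex) \<Rightarrow> complex"
  where "cartan_number \<alpha> \<beta> = 2 * dual_form \<alpha> \<beta> / dual_form \<alpha> \<alpha>"

lemma bracket_coroot:
  assumes "\<alpha> \<in> roots" and "\<beta> \<in> representable" and "z \<in> root_space \<beta>"
  shows "bracket (coroot \<alpha>) z = scale (cartan_number \<alpha> \<beta>) z"
  using bracket_dual_vector[OF root_representable[OF assms(1)] assms(2,3)]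
  by (simp add: coroot_def cartan_number_def bracket_scale_left)

lemma sl2_triple_exists:
  assumes a: "\<alpha> \<in> nonisotropic_roots" and e: "e \<in> root_space \<alpha>" "e \<noteq> 0"
  obtains f where "f \<in> root_space (- \<alpha>)" and "sl2_triple e (coroot \<alpha>) f" and "form e f \<noteq> 0"
proof -
  have r: "\<alpha> \<in> roots" and nz: "dual_form \<alpha> \<alpha> \<noteq> 0" using a by (auto simp: nonisotropic_iff)
  obtain y where y: "y \<in> root_space (- \<alpha>)" "form e y \<noteq> 0"
    using form_pairing_nonzero[OF roots_dual[OF r] e] .
  define f where "f = scale (2 / (dual_form \<alpha> \<alpha> * form e y)) y"
  have f: "f \<in> root_space (- \<alpha>)" unfolding f_def using y(1) root_space_subspace subspace_scale by blast
  have ef: "form e f = 2 / dual_form \<alpha> \<alpha>" using y(2) by (simp add: f_def form_scale_right)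
  have "bracket e f = coroot \<alpha>" using bracket_opposite[OF r e(1) f] ef by (simp add: coroot_def)
  moreover have "bracket (coroot \<alpha>) e = scale 2 e"
    using bracket_coroot[OF r root_representable[OF r] e(1)] nz by (simp add: cartan_number_def)
  moreover have "bracket (coroot \<alpha>) f = scale (- 2) f"
    using bracket_coroot[OF r root_representable[OF uminus_root[OF r]] f] nz r
    by (simp add: cartan_number_def dual_form_simps)
  ultimately have "sl2_triple e (coroot \<alpha>) f" by (simp add: sl2_triple_def)
  moreover have "form e f \<noteq> 0" using ef nz by simp
  ultimately show thesis using f that by blast
qed

lemma cartan_number_integral:
  assumes "\<alpha> \<in> nonisotropic_roots" and "\<beta> \<in> roots"
  shows "\<exists>p::int. cartan_number \<alpha> \<beta> = of_int p"
proof -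
  obtain e where e: "e \<in> root_space \<alpha>" "e \<noteq> 0"
    using root_space_nonzero nonisotropic_root assms(1) by blast
  obtain f where f: "f \<in> root_space (- \<alpha>)" "sl2_triple e (coroot \<alpha>) f"
    using sl2_triple_exists[OF assms(1) e] by blast
  obtain z where z: "z \<in> root_space \<beta>" "z \<noteq> 0" using root_space_nonzero assms(2) by blast
  show ?thesis
    using sl2_weight_integral[OF f(2)] locally_nilpotent[OF assms(1) e(1)]
      locally_nilpotent[OF uminus_nonisotropic[OF assms(1)] f(1)]
      bracket_coroot[OF nonisotropic_root[OF assms(1)] root_representable[OF assms(2)] z(1)] z(2)
    by blast
qed

text \<open>
  If the bracket vanished, \<open>z\<close> would be a primitive vector of negative weight.
\<close>

lemma bracket_nonzero:
  assumes a: "\<alpha> \<in> nonisotropic_roots" and b: "\<beta> \<in> roots"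
    and p: "cartan_number \<alpha> \<beta> = of_int p" "p < 0"
    and x: "x \<in> root_space \<alpha>" "x \<noteq> 0" and z: "z \<in> root_space \<beta>" "z \<noteq> 0"
  shows "bracket x z \<noteq> 0"
proof
  assume "bracket x z = 0"
  obtain f where f: "f \<in> root_space (- \<alpha>)" "sl2_triple x (coroot \<alpha>) f"
    using sl2_triple_exists[OF a x] by blast
  then obtain j :: nat where "cartan_number \<alpha> \<beta> = of_nat j"
    using sl2_primitive_weight[OF f(2) locally_nilpotent[OF uminus_nonisotropic[OF a] f(1)]
        bracket_coroot[OF nonisotropic_root[OF a] root_representable[OF b] z(1)]]
      \<open>bracket x z = 0\<close> z(2) by blast
  with p have "(of_int p :: complex) = of_int (int j)" by simp
  then have "p = int j" by (simp only: of_int_eq_iff)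
  with p(2) show False by simp
qed

lemma add_root:
  assumes "\<alpha> \<in> nonisotropic_roots" and "\<beta> \<in> roots"
    and "cartan_number \<alpha> \<beta> = of_int p" and "p < 0"
  shows "\<alpha> + \<beta> \<in> roots"
proof -
  obtain x z where "x \<in> root_space \<alpha>" "x \<noteq> 0" "z \<in> root_space \<beta>" "z \<noteq> 0"
    using root_space_nonzero nonisotropic_root assms(1,2) by metis
  then show ?thesis
    using bracket_nonzero[OF assms] root_space_bracket[of x \<alpha> z \<beta>]
      rootI[OF dual_add] roots_dual nonisotropic_root assms(1,2) by blast
qed

lemma ad_power_root_space:
  assumes "y \<in> root_space \<delta>" and "z \<in> root_space \<beta>"
  shows "(bracket y ^^ n) z \<in> root_space (\<beta> + rscale (of_nat n) \<delta>)"
proof (induction n)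
  case 0
  then show ?case using assms by simp
next
  case (Suc n)
  have "\<delta> + (\<beta> + rscale (of_nat n) \<delta>) = \<beta> + rscale (of_nat (Suc n)) \<delta>"
    by (simp add: rscale_def fun_eq_iff algebra_simps)
  then show ?case using root_space_bracket[OF assms(1) Suc] by (simp only: funpow.simps o_apply)
qed

lemma dual_rscale: "\<alpha> \<in> dual \<Longrightarrow> rscale r \<alpha> \<in> dual"
  by (auto simp: dual_def rscale_def algebra_simps)

lemma string_rootI:
  assumes "\<beta> \<in> roots" and "\<delta> \<in> roots" and "v \<in> root_space (\<beta> + rscale r \<delta>)" and "v \<noteq> 0"
  shows "\<beta> + rscale r \<delta> \<in> roots"
  using rootI[OF dual_add[OF roots_dual[OF assms(1)] dual_rscale[OF roots_dual[OF assms(2)]]]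
      assms(3,4)] .

lemma reflection_root:
  assumes a: "\<alpha> \<in> nonisotropic_roots" and b: "\<beta> \<in> roots" and m: "cartan_number \<alpha> \<beta> = of_nat m"
  shows "\<beta> + rscale (of_nat m) (- \<alpha>) \<in> roots"
proof -
  obtain e where e: "e \<in> root_space \<alpha>" "e \<noteq> 0"
    using root_space_nonzero nonisotropic_root a by blast
  obtain f where f: "f \<in> root_space (- \<alpha>)" "sl2_triple e (coroot \<alpha>) f"
    using sl2_triple_exists[OF a e] by blast
  obtain z where z: "z \<in> root_space \<beta>" "z \<noteq> 0" using root_space_nonzero b by blast
  obtain k where "(bracket e ^^ k) z = 0"
    using locally_nilpotent[OF a e(1)] by (auto simp: ad_locally_nilpotent_def)
  then have "(bracket f ^^ m) z \<noteq> 0"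
    using sl2_lowering_injective[OF f(2)] z(2) m
      bracket_coroot[OF nonisotropic_root[OF a] root_representable[OF b] z(1)] by metis
  then show ?thesis
    using string_rootI[OF b uminus_root[OF nonisotropic_root[OF a]]
        ad_power_root_space[OF f(1) z(1)]] by blast
qed

text \<open>
  Subtract a multiple of \<open>y\<close> from \<open>x\<close> to make it orthogonal to \<open>f\<close>. The difference then commutes
  with \<open>f\<close>, so it would be a lowest weight vector of positive weight \<open>2\<close> unless it is zero.
\<close>

lemma root_space_one_dimensional:
  assumes a: "\<alpha> \<in> nonisotropic_roots" and x: "x \<in> root_space \<alpha>" and y: "y \<in> root_space \<alpha>" "y \<noteq> 0"
  shows "\<exists>c. x = scale c y"
proof -
  have r: "\<alpha> \<in> roots" and nz: "dual_form \<alpha> \<alpha> \<noteq> 0" using a by (auto simp: nonisotropic_iff)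
  obtain f where f: "f \<in> root_space (- \<alpha>)" "form y f \<noteq> 0"
    using sl2_triple_exists[OF a y] by blast
  let ?d = "x - scale (form x f / form y f) y"
  have d: "?d \<in> root_space \<alpha>"
    using x y(1) root_space_subspace subspace_diff subspace_scale by blast
  have "form ?d f = 0" using f(2) by (simp add: form_diff_left form_scale_left)
  then have "bracket f ?d = 0"
    using bracket_opposite[OF r d f(1)] bracket_swap[of f ?d] by simp
  moreover have "cartan_number (- \<alpha>) \<alpha> = of_int (- 2)"
    using nz r by (simp add: cartan_number_def dual_form_simps)
  ultimately have "?d = 0"
    using bracket_nonzero[OF uminus_nonisotropic[OF a] r, of "- 2" f ?d] d f by force
  then show ?thesis by auto
qed

section \<open>Isotropic roots are orthogonal to all roots\<close>

text \<open>
  Opposite vectors in \<open>E\<^sub>\<delta>\<close> and \<open>E\<^sub>-\<^sub>\<delta>\<close> span a Heisenberg algebra with central element \<open>t\<^sub>\<delta>\<close>, which acts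
  on \<open>E\<^sub>\<beta>\<close> by \<open>(\<delta>, \<beta>)\<close>.
\<close>

lemma infinite_isotropic_string:
  assumes d: "\<delta> \<in> isotropic_roots" and b: "\<beta> \<in> roots" and nz: "dual_form \<delta> \<beta> \<noteq> 0"
  shows "\<exists>\<delta>'\<in>{\<delta>, - \<delta>}. \<exists>N::nat. \<forall>k\<ge>N. \<beta> + rscale (of_nat k) \<delta>' \<in> roots"
proof -
  have dr: "\<delta> \<in> roots" and d0: "dual_form \<delta> \<delta> = 0" using d by (auto simp: isotropic_iff)
  obtain x where x: "x \<in> root_space \<delta>" "x \<noteq> 0" using root_space_nonzero dr by blast
  obtain y where y: "y \<in> root_space (- \<delta>)" "form x y \<noteq> 0"
    using form_pairing_nonzero[OF roots_dual[OF dr] x] .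
  obtain z where z: "z \<in> root_space \<beta>" "z \<noteq> 0" using root_space_nonzero b by blast
  let ?t = "scale (form x y) (dual_vector \<delta>)"
  have xy: "bracket x y = ?t" by (rule bracket_opposite[OF dr x(1) y(1)])
  have t: "bracket ?t v = scale (form x y * dual_form \<delta> \<gamma>) v"
    if "\<gamma> \<in> roots" "v \<in> root_space \<gamma>" for v \<gamma>
    using bracket_dual_vector[OF _ _ that(2), of \<delta>] dr that(1)
    by (simp add: bracket_scale_left root_representable)
  have "bracket ?t x = 0" "bracket ?t y = 0"
    unfolding t[OF dr x(1)] t[OF uminus_root[OF dr] y(1)]
      dual_form_uminus_right[OF root_representable[OF dr] root_representable[OF dr]] d0 by simp_all
  note heis = heisenberg_unbounded[OF xy this t[OF b z(1)] _ z(2)]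
  have up: "\<beta> + rscale (of_nat n) \<delta> \<in> roots" if "(bracket x ^^ n) z \<noteq> 0" for n
    using string_rootI[OF b dr ad_power_root_space[OF x(1) z(1)] that] .
  have down: "\<beta> + rscale (of_nat n) (- \<delta>) \<in> roots"
    if "k \<le> n" and "\<And>n. (bracket y ^^ n) ((bracket x ^^ k) z) \<noteq> 0" for n k
  proof -
    have "(bracket y ^^ (n + k)) ((bracket x ^^ k) z)
        \<in> root_space (\<beta> + rscale (of_nat k) \<delta> + rscale (of_nat (n + k)) (- \<delta>))"
      by (rule ad_power_root_space[OF y(1) ad_power_root_space[OF x(1) z(1)]])
    also have "\<beta> + rscale (of_nat k) \<delta> + rscale (of_nat (n + k)) (- \<delta>)
        = \<beta> + rscale (of_nat n) (- \<delta>)"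
      by (simp add: rscale_def fun_eq_iff algebra_simps)
    finally show ?thesis using that(2) string_rootI[OF b uminus_root[OF dr]] by blast
  qed
  from heis nz y(2) consider "\<forall>n. (bracket x ^^ n) z \<noteq> 0"
    | k where "\<forall>n. (bracket y ^^ n) ((bracket x ^^ k) z) \<noteq> 0"
    by auto
  then show ?thesis
  proof cases
    case 1
    then show ?thesis using up by blast
  next
    case (2 k)
    then show ?thesis using down[of k] by blast
  qed
qed

text \<open>
  If \<open>(\<delta>, \<alpha>) \<noteq> 0\<close> then \<open>\<alpha> + k \<delta>\<close> would be a root for infinitely many \<open>k\<close>. Its Cartan number with
  \<open>\<alpha>\<close> is \<open>1 + (\<alpha>, \<alpha>) / (\<alpha> + k \<delta>, \<alpha> + k \<delta>)\<close>, an integer different from \<open>1\<close> that tends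
  to \<open>1\<close> because the denominator grows linearly in \<open>k\<close>.
\<close>

lemma isotropic_orthogonal_nonisotropic:
  assumes d: "\<delta> \<in> isotropic_roots" and a: "\<alpha> \<in> nonisotropic_roots"
  shows "dual_form \<delta> \<alpha> = 0"
proof (rule ccontr)
  assume "dual_form \<delta> \<alpha> \<noteq> 0"
  then obtain \<delta>' N where d': "\<delta>' \<in> {\<delta>, - \<delta>}" and
    N: "\<And>k. k \<ge> N \<Longrightarrow> \<alpha> + rscale (of_nat k) \<delta>' \<in> roots"
    using infinite_isotropic_string[OF d nonisotropic_root[OF a]] by blast
  have ar: "\<alpha> \<in> roots" using a by (rule nonisotropic_root)
  have dr: "\<delta>' \<in> roots" and dd: "dual_form \<delta>' \<delta>' = 0"
    using d d' uminus_isotropic by (auto simp: isotropic_iff)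
  define q where "q = dual_form \<alpha> \<alpha>"
  define s where "s = dual_form \<alpha> \<delta>'"
  have q: "q \<noteq> 0" using a by (simp add: q_def nonisotropic_iff)
  have s: "s \<noteq> 0" using \<open>dual_form \<delta> \<alpha> \<noteq> 0\<close> d' d ar dual_form_sym[of \<alpha> \<delta>]
    by (auto simp: s_def dual_form_simps isotropic_iff)
  have bound: "norm (q + of_nat (2 * k) * s) \<le> norm q" if k: "k \<ge> N" for k
  proof (cases "q + of_nat (2 * k) * s = 0")
    case False
    let ?b = "\<alpha> + rscale (of_nat k) \<delta>'"
    have len: "dual_form ?b ?b = q + of_nat (2 * k) * s"
      using ar dr dd by (simp add: dual_form_simps q_def s_def dual_form_sym[of \<delta>' \<alpha>])
    have "?b \<in> nonisotropic_roots" using N[OF k] len False by (simp add: nonisotropic_iff)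
    then obtain p :: int where "cartan_number ?b \<alpha> = of_int p"
      using cartan_number_integral ar by blast
    moreover have "dual_form ?b \<alpha> = q + of_nat k * s"
      using ar dr by (simp add: dual_form_simps q_def s_def dual_form_sym[of \<delta>' \<alpha>])
    ultimately have "2 * (q + of_nat k * s) = of_int p * (q + of_nat (2 * k) * s)"
      using False unfolding cartan_number_def len by (simp add: field_simps)
    then have eq: "q = of_int (p - 1) * (q + of_nat (2 * k) * s)"
      by (simp add: algebra_simps)
    then have "p - 1 \<noteq> 0" using q by (metis mult_zero_left of_int_0)
    then have "1 \<le> norm (of_int (p - 1) :: complex)" unfolding norm_of_int by linarith
    then have "1 * norm (q + of_nat (2 * k) * s)
        \<le> norm (of_int (p - 1) :: complex) * norm (q + of_nat (2 * k) * s)"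
      by (intro mult_right_mono) auto
    also have "\<dots> = norm q" using arg_cong[OF eq, of norm] by (simp only: norm_mult)
    finally show ?thesis by simp
  qed simp
  obtain k0 :: nat where k0: "norm q < of_nat k0 * norm s"
    using reals_Archimedean3[of "norm s"] s by auto
  define k where "k = max N k0"
  have "norm (of_nat (2 * k) * s) \<le> norm (q + of_nat (2 * k) * s) + norm q"
    by (metis add_diff_cancel_left' norm_triangle_ineq4)
  also have "\<dots> \<le> 2 * norm q" using bound[of k] by (simp add: k_def)
  finally have "of_nat k * norm s \<le> norm q" by (simp add: norm_mult)
  moreover have "of_nat k0 * norm s \<le> of_nat k * norm s"
    by (intro mult_right_mono) (auto simp: k_def)
  ultimately show False using k0 by linarith
qed

text \<open>
  For two isotropic roots with \<open>(\<delta>, \<beta>) \<noteq> 0\<close>, the string through \<open>\<beta>\<close> would contain nonisotropic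
  roots that are not orthogonal to \<open>\<delta>\<close>.
\<close>

lemma isotropic_orthogonal:
  assumes d: "\<delta> \<in> isotropic_roots" and b: "\<beta> \<in> roots"
  shows "dual_form \<delta> \<beta> = 0"
proof (cases "\<beta> \<in> nonisotropic_roots")
  case True
  with d show ?thesis by (rule isotropic_orthogonal_nonisotropic)
next
  case False
  then have b0: "dual_form \<beta> \<beta> = 0" using b by (simp add: nonisotropic_iff)
  show ?thesis
  proof (rule ccontr)
    assume nz: "dual_form \<delta> \<beta> \<noteq> 0"
    then obtain \<delta>' and N :: nat where d': "\<delta>' \<in> {\<delta>, - \<delta>}" and
      N: "\<And>k. k \<ge> N \<Longrightarrow> \<beta> + rscale (of_nat k) \<delta>' \<in> roots"
      using infinite_isotropic_string[OF d b] by blast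
    have di: "\<delta>' \<in> isotropic_roots" using d d' uminus_isotropic by auto
    then have dr: "\<delta>' \<in> roots" and dd: "dual_form \<delta>' \<delta>' = 0" by (auto simp: isotropic_iff)
    have s: "dual_form \<delta>' \<beta> \<noteq> 0" using nz d' d b by (auto simp: dual_form_simps isotropic_iff)
    let ?b = "\<beta> + rscale (of_nat (Suc N)) \<delta>'"
    have "dual_form ?b ?b = 2 * of_nat (Suc N) * dual_form \<delta>' \<beta>"
      using b dr dd b0 by (simp add: dual_form_simps dual_form_sym[of \<beta> \<delta>'] del: of_nat_Suc)
    then have "?b \<in> nonisotropic_roots"
      using N[of "Suc N"] s by (simp add: nonisotropic_iff del: of_nat_Suc)
    moreover have "dual_form \<delta>' ?b = dual_form \<delta>' \<beta>"
      using b dr dd by (simp add: dual_form_simps)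
    ultimately show False using isotropic_orthogonal_nonisotropic[OF di] s by metis
  qed
qed

end

section \<open>Simply laced Cartan matrices are positive semidefinite\<close>

definition dynkin_adjacent :: "ade_type \<Rightarrow> nat \<Rightarrow> nat \<Rightarrow> bool"
  where "dynkin_adjacent X i j \<longleftrightarrow>
    i \<noteq> j \<and> ((i, j) \<in> dynkin_edges X \<or> (j, i) \<in> dynkin_edges X)"

lemma dynkin_adjacent_sym: "dynkin_adjacent X i j = dynkin_adjacent X j i"
  by (auto simp: dynkin_adjacent_def)

lemma cartan_matrix_adjacent:
  "cartan_matrix X i j = (if i = j then 2 else - of_bool (dynkin_adjacent X i j))"
  by (auto simp: cartan_matrix_def dynkin_adjacent_def)

text \<open>
  A positive vector \<open>v\<close> with \<open>A v \<le> 2 v\<close> bounds the quadratic form of a nonnegative symmetric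
  matrix \<open>A\<close>, by the inequality \<open>2 k\<^sub>i k\<^sub>j \<le> (v\<^sub>j / v\<^sub>i) k\<^sub>i\<^sup>2 + (v\<^sub>i / v\<^sub>j) k\<^sub>j\<^sup>2\<close>.
\<close>

lemma quadratic_form_le_of_supervector:
  fixes A :: "nat \<Rightarrow> nat \<Rightarrow> real" and v k :: "nat \<Rightarrow> real"
  assumes sym: "\<And>i j. A i j = A j i" and nonneg: "\<And>i j. 0 \<le> A i j" and pos: "\<And>i. 0 < v i"
    and super: "\<And>i. i < n \<Longrightarrow> (\<Sum>j<n. A i j * v j) \<le> 2 * v i"
  shows "(\<Sum>i<n. \<Sum>j<n. A i j * (k i * k j)) \<le> 2 * (\<Sum>i<n. (k i)\<^sup>2)"
proof -
  define B where "B i j = A i j * (v j / v i * (k i)\<^sup>2)" for i j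
  have B: "A i j * (k i * k j) \<le> (B i j + B j i) / 2" for i j
  proof -
    have "0 \<le> (v j * k i - v i * k j)\<^sup>2" by simp
    then have "2 * (v i * v j * (k i * k j)) \<le> (v j * k i)\<^sup>2 + (v i * k j)\<^sup>2"
      by (simp add: power2_eq_square algebra_simps)
    then have "2 * (k i * k j) \<le> v j / v i * (k i)\<^sup>2 + v i / v j * (k j)\<^sup>2"
      using pos[of i] pos[of j] by (simp add: field_simps power2_eq_square)
    then have "A i j * (2 * (k i * k j)) \<le> A i j * (v j / v i * (k i)\<^sup>2 + v i / v j * (k j)\<^sup>2)"
      using nonneg by (rule mult_left_mono)
    then show ?thesis by (simp add: B_def sym[of j i] algebra_simps)
  qed
  have "(\<Sum>i<n. \<Sum>j<n. A i j * (k i * k j)) \<le> (\<Sum>i<n. \<Sum>j<n. (B i j + B j i) / 2)"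
    by (intro sum_mono B)
  also have "\<dots> = ((\<Sum>i<n. \<Sum>j<n. B i j) + (\<Sum>i<n. \<Sum>j<n. B j i)) / 2"
    by (simp add: sum.distrib flip: sum_divide_distrib)
  also have "(\<Sum>i<n. \<Sum>j<n. B j i) = (\<Sum>i<n. \<Sum>j<n. B i j)" by (rule sum.swap)
  also have "((\<Sum>i<n. \<Sum>j<n. B i j) + (\<Sum>i<n. \<Sum>j<n. B i j)) / 2
      = (\<Sum>i<n. (k i)\<^sup>2 / v i * (\<Sum>j<n. A i j * v j))"
    by (simp add: B_def sum_distrib_left mult_ac)
  also have "\<dots> \<le> (\<Sum>i<n. (k i)\<^sup>2 / v i * (2 * v i))"
    using pos super by (intro sum_mono mult_left_mono divide_nonneg_pos) auto
  also have "\<dots> = 2 * (\<Sum>i<n. (k i)\<^sup>2)"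
    using pos by (simp add: sum_distrib_left less_imp_neq[THEN not_sym] mult.commute)
  finally show ?thesis .
qed

lemma neighbour_sum_le:
  fixes v :: "nat \<Rightarrow> real"
  assumes "\<And>j. j < n \<Longrightarrow> P j \<Longrightarrow> j \<in> set S" and "\<And>j. 0 \<le> v j"
  shows "(\<Sum>j<n. of_bool (P j) * v j) \<le> sum_list (map v S)"
proof -
  have "(\<Sum>j<n. of_bool (P j) * v j) = (\<Sum>j<n. if P j then v j else 0)"
    by (intro sum.cong) auto
  also have "\<dots> = (\<Sum>j\<in>{j \<in> {..<n}. P j}. v j)"
    by (rule sum.inter_filter[symmetric]) simp
  also have "\<dots> \<le> sum v (set S)" using assms by (intro sum_mono2) auto
  also have "\<dots> \<le> sum_list (map v S)"
    using assms(2)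
  proof (induction S)
    case (Cons a S)
    then show ?case by (cases "a \<in> set S") (auto simp: insert_absorb add_increasing)
  qed simp
  finally show ?thesis .
qed

text \<open>
  The vectors come from the affine diagrams: constant for \<open>A\<close>, equal to \<open>2\<close> along the chain and
  to \<open>1\<close> at the two branches of the fork for \<open>D\<close>, and the marks of affine \<open>E\<^sub>8\<close> for \<open>E\<close>, where the
  diagrams of \<open>E\<^sub>6\<close> and \<open>E\<^sub>7\<close> are parts of the one of \<open>E\<^sub>8\<close>.
\<close>

lemma dynkin_supervector:
  assumes "ade_valid X"
  shows "\<exists>v::nat \<Rightarrow> real. (\<forall>i. 0 < v i) \<and>
    (\<forall>i<ade_rank X. (\<Sum>j<ade_rank X. of_bool (dynkin_adjacent X i j) * v j) \<le> 2 * v i)"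
proof (cases X)
  case (Type_A l)
  have "(\<Sum>j<l. of_bool (dynkin_adjacent X i j) * (1::real)) \<le> 2 * 1" for i
    by (rule order_trans[OF neighbour_sum_le[where S = "[i - 1, i + 1]"]])
      (auto simp: Type_A dynkin_adjacent_def)
  then show ?thesis by (intro exI[of _ "\<lambda>_. 1"]) (auto simp: Type_A)
next
  case (Type_D l)
  with assms have l: "4 \<le> l" by simp
  define v :: "nat \<Rightarrow> real" where "v j = (if l \<le> j + 2 then 1 else 2)" for j
  have "(\<Sum>j<l. of_bool (dynkin_adjacent X i j) * v j) \<le> 2 * v i" if i: "i < l" for i
  proof -
    consider "i + 3 < l" | "i + 3 = l" | "l < i + 3" by linarith
    then show ?thesis
    proof cases
      case 1
      then show ?thesis
        by (intro order_trans[OF neighbour_sum_le[where S = "[i - 1, i + 1]"]])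
          (auto simp: Type_D dynkin_adjacent_def v_def)
    next
      case 2
      then show ?thesis using l
        by (intro order_trans[OF neighbour_sum_le[where S = "[i - 1, i + 1, i + 2]"]])
          (auto simp: Type_D dynkin_adjacent_def v_def)
    next
      case 3
      then show ?thesis using l i
        by (intro order_trans[OF neighbour_sum_le[where S = "[l - 3]"]])
          (auto simp: Type_D dynkin_adjacent_def v_def)
    qed
  qed
  then show ?thesis by (intro exI[of _ v]) (auto simp: Type_D v_def)
next
  case (Type_E l)
  with assms have l: "l \<le> 8" by auto
  define v :: "nat \<Rightarrow> real" where "v j = (if j < 8 then [2, 3, 4, 6, 5, 4, 3, 2] ! j else 1)" for j
  have v: "v 0 = 2" "v 1 = 3" "v 2 = 4" "v 3 = 6" "v 4 = 5" "v 5 = 4" "v 6 = 3" "v 7 = 2"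
    by (simp_all add: v_def)
  have pos: "0 < v j" for j
  proof (cases "j < 8")
    case True
    then have "j \<in> {0, 1, 2, 3, 4, 5, 6, 7}" by auto
    then show ?thesis using v by auto
  qed (simp add: v_def)
  have bound: "(\<Sum>j<l. of_bool (dynkin_adjacent X i j) * v j) \<le> sum_list (map v S)"
    if "\<And>j. j < l \<Longrightarrow> dynkin_adjacent X i j \<Longrightarrow> j \<in> set S" for i S
    by (rule neighbour_sum_le[OF that]) (use pos less_imp_le in auto)
  have "(\<Sum>j<l. of_bool (dynkin_adjacent X i j) * v j) \<le> 2 * v i" if i: "i < l" for i
  proof -
    have "i \<in> {0, 1, 2, 3, 4, 5, 6, 7}" using i l by auto
    then consider "i = 0" | "i = 1" | "i = 2" | "i = 3" | "i = 4" | "i = 5" | "i = 6" | "i = 7"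
      by auto
    then show ?thesis
    proof cases
      case 1
      show ?thesis
        by (rule order_trans[OF bound[where S = "[2]"]])
          (use 1 v in \<open>auto simp: Type_E dynkin_adjacent_def\<close>)
    next
      case 2
      show ?thesis
        by (rule order_trans[OF bound[where S = "[3]"]])
          (use 2 v in \<open>auto simp: Type_E dynkin_adjacent_def\<close>)
    next
      case 3
      show ?thesis
        by (rule order_trans[OF bound[where S = "[0, 3]"]])
          (use 3 v in \<open>auto simp: Type_E dynkin_adjacent_def\<close>)
    next
      case 4
      show ?thesis
        by (rule order_trans[OF bound[where S = "[1, 2, 4]"]])
          (use 4 v in \<open>auto simp: Type_E dynkin_adjacent_def\<close>)
    next
      case 5
      show ?thesis
        by (rule order_trans[OF bound[where S = "[3, 5]"]])
          (use 5 v in \<open>auto simp: Type_E dynkin_adjacent_def\<close>)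
    next
      case 6
      show ?thesis
        by (rule order_trans[OF bound[where S = "[4, 6]"]])
          (use 6 v in \<open>auto simp: Type_E dynkin_adjacent_def\<close>)
    next
      case 7
      show ?thesis
        by (rule order_trans[OF bound[where S = "[5, 7]"]])
          (use 7 v in \<open>auto simp: Type_E dynkin_adjacent_def\<close>)
    next
      case 8
      show ?thesis
        by (rule order_trans[OF bound[where S = "[6]"]])
          (use 8 l v in \<open>auto simp: Type_E dynkin_adjacent_def\<close>)
    qed
  qed
  then show ?thesis using pos by (intro exI[of _ v]) (auto simp: Type_E)
qed

definition cartan_form :: "ade_type \<Rightarrow> (nat \<Rightarrow> int) \<Rightarrow> (nat \<Rightarrow> int) \<Rightarrow> int"
  where "cartan_form X k l = (\<Sum>i<ade_rank X. \<Sum>j<ade_rank X. k i * l j * cartan_matrix X i j)"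

lemma cartan_form_nonneg:
  assumes "ade_valid X"
  shows "0 \<le> cartan_form X k k"
proof -
  let ?n = "ade_rank X"
  let ?k = "\<lambda>i. real_of_int (k i)"
  obtain v :: "nat \<Rightarrow> real" where v: "\<And>i. 0 < v i"
    "\<And>i. i < ?n \<Longrightarrow> (\<Sum>j<?n. of_bool (dynkin_adjacent X i j) * v j) \<le> 2 * v i"
    using dynkin_supervector[OF assms] by blast
  have bound: "(\<Sum>i<?n. \<Sum>j<?n. of_bool (dynkin_adjacent X i j) * (?k i * ?k j)) \<le> 2 * (\<Sum>i<?n. (?k i)\<^sup>2)"
    by (rule quadratic_form_le_of_supervector[of _ v]) (use v in \<open>auto simp: dynkin_adjacent_sym\<close>)
  have row: "(\<Sum>j<?n. ?k i * ?k j * of_int (cartan_matrix X i j))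
      = 2 * (?k i)\<^sup>2 - (\<Sum>j<?n. of_bool (dynkin_adjacent X i j) * (?k i * ?k j))"
    if i: "i < ?n" for i
  proof -
    have "(\<Sum>j<?n. ?k i * ?k j * of_int (cartan_matrix X i j))
        = (\<Sum>j<?n. (if j = i then 2 * (?k i)\<^sup>2 else 0)
            - of_bool (dynkin_adjacent X i j) * (?k i * ?k j))"
      by (intro sum.cong)
        (auto simp: cartan_matrix_adjacent dynkin_adjacent_def power2_eq_square)
    also have "\<dots> = 2 * (?k i)\<^sup>2 - (\<Sum>j<?n. of_bool (dynkin_adjacent X i j) * (?k i * ?k j))"
      using i by (simp add: sum_subtractf)
    finally show ?thesis .
  qed
  have "real_of_int (cartan_form X k k)
      = (\<Sum>i<?n. \<Sum>j<?n. ?k i * ?k j * of_int (cartan_matrix X i j))"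
    by (simp add: cartan_form_def)
  also have "\<dots> = 2 * (\<Sum>i<?n. (?k i)\<^sup>2)
      - (\<Sum>i<?n. \<Sum>j<?n. of_bool (dynkin_adjacent X i j) * (?k i * ?k j))"
    using row by (simp add: sum_subtractf sum_distrib_left)
  finally have "0 \<le> real_of_int (cartan_form X k k)" using bound by linarith
  then show ?thesis by simp
qed

lemma dynkin_connected:
  assumes X: "ade_valid X" and i: "i < ade_rank X"
    and f: "\<And>i j. \<lbrakk>i < ade_rank X; j < ade_rank X; dynkin_adjacent X i j\<rbrakk> \<Longrightarrow> f i = f j"
  shows "f i = f 0"
proof (cases X)
  case (Type_A l)
  have chain: "i < l \<longrightarrow> f i = f 0" for i
  proof (induction i)
    case (Suc i)
    then show ?case using f[of i "Suc i"] by (auto simp: Type_A dynkin_adjacent_def)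
  qed simp
  show ?thesis using chain[of i] i by (simp add: Type_A)
next
  case (Type_D l)
  then have l: "4 \<le> l" using X by simp
  have chain: "i + 1 < l \<longrightarrow> f i = f 0" for i
  proof (induction i)
    case (Suc i)
    have "f i = f (Suc i)" if "Suc i + 1 < l"
      by (rule f) (use that in \<open>auto simp: Type_D dynkin_adjacent_def\<close>)
    with Suc show ?case by simp
  qed simp
  have "f (l - 3) = f (l - 1)" by (rule f) (use l in \<open>auto simp: Type_D dynkin_adjacent_def\<close>)
  then have "f (l - 1) = f 0" using chain[of "l - 3"] l by simp
  then show ?thesis using chain[of i] i by (cases "i = l - 1") (auto simp: Type_D)
next
  case (Type_E l)
  then have l: "6 \<le> l" using X by auto
  have f0: "f 0 = f 2" by (rule f) (use l in \<open>auto simp: Type_E dynkin_adjacent_def\<close>)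
  have f1: "f 1 = f 3" by (rule f) (use l in \<open>auto simp: Type_E dynkin_adjacent_def\<close>)
  have chain: "j + 2 < l \<longrightarrow> f (j + 2) = f 2" for j
  proof (induction j)
    case (Suc j)
    have "f (j + 2) = f (Suc j + 2)" if "Suc j + 2 < l"
      by (rule f) (use that in \<open>auto simp: Type_E dynkin_adjacent_def\<close>)
    with Suc show ?case by simp
  qed (simp add: numeral_2_eq_2)
  consider "i = 0" | "i = 1" | "i = (i - 2) + 2" by linarith
  then show ?thesis
  proof cases
    case 2
    then show ?thesis using f0 f1 chain[of 1] l by (simp add: numeral_3_eq_3)
  next
    case 3
    then show ?thesis using f0 chain[of "i - 2"] i by (simp add: Type_E)
  qed simp
qed

section \<open>Lengths and Cartan numbers in simply laced type\<close>

context lie_datum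
begin

lemma isotropic_span_subspace: "fun_real.subspace isotropic_real_span"
  unfolding isotropic_real_span_def by (rule fun_real.subspace_span)

lemma coset_eq_iff: "coset \<alpha> = coset \<beta> \<longleftrightarrow> \<alpha> - \<beta> \<in> isotropic_real_span"
proof
  assume "coset \<alpha> = coset \<beta>"
  moreover have "\<alpha> \<in> coset \<alpha>"
    using fun_real.subspace_0[OF isotropic_span_subspace] by (simp add: coset_def)
  ultimately show "\<alpha> - \<beta> \<in> isotropic_real_span" by (simp add: coset_def)
next
  assume d: "\<alpha> - \<beta> \<in> isotropic_real_span"
  have "\<gamma> - \<alpha> \<in> isotropic_real_span \<longleftrightarrow> \<gamma> - \<beta> \<in> isotropic_real_span" for \<gamma>
    using fun_real.subspace_add[OF isotropic_span_subspace _ d, of "\<gamma> - \<alpha>"]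
      fun_real.subspace_diff[OF isotropic_span_subspace _ d, of "\<gamma> - \<beta>"]
    by auto
  then show "coset \<alpha> = coset \<beta>" by (auto simp: coset_def)
qed

end

context eala
begin

lemma isotropic_span_orthogonal:
  assumes "\<delta> \<in> isotropic_real_span"
  shows "\<delta> \<in> representable \<and> (\<forall>\<beta>\<in>roots. dual_form \<delta> \<beta> = 0)"
proof -
  let ?S = "{\<delta> \<in> representable. \<forall>\<beta>\<in>roots. dual_form \<delta> \<beta> = 0}"
  have "fun_real.subspace ?S"
    unfolding fun_real.subspace_def
    using fun_real.subspace_0[OF representable_subspace] dual_form_rscale_left[of 0 _ 0]
    by (auto simp: dual_form_simps)
  moreover have "isotropic_roots \<subseteq> ?S"
    using isotropic_orthogonal root_representable by (auto simp: isotropic_iff)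
  ultimately have "isotropic_real_span \<subseteq> ?S"
    unfolding isotropic_real_span_def by (intro fun_real.span_minimal)
  with assms show ?thesis by blast
qed

lemma dual_form_sum_left:
  assumes "\<And>i. i \<in> I \<Longrightarrow> f i \<in> representable" and "\<beta> \<in> representable"
  shows "dual_form (\<Sum>i\<in>I. f i) \<beta> = (\<Sum>i\<in>I. dual_form (f i) \<beta>)"
  using assms(1)
proof (induction I rule: infinite_finite_induct)
  case (insert i I)
  have "(\<Sum>i\<in>I. f i) \<in> representable"
    using insert by (intro fun_real.subspace_sum[OF representable_subspace]) auto
  then have "dual_form (f i + (\<Sum>i\<in>I. f i)) \<beta> = dual_form (f i) \<beta> + (\<Sum>i\<in>I. dual_form (f i) \<beta>)"
    using insert assms(2) by (subst dual_form_add_left) auto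
  then show ?case unfolding sum.insert[OF insert.hyps] .
qed (use dual_form_rscale_left[of 0 _ 0] fun_real.subspace_0[OF representable_subspace] assms(2) in auto)

end

locale simply_laced_eala = eala scale bracket form H
  for scale :: "complex \<Rightarrow> 'a::ab_group_add \<Rightarrow> 'a"
    and bracket :: "'a \<Rightarrow> 'a \<Rightarrow> 'a"
    and form :: "'a \<Rightarrow> 'a \<Rightarrow> complex"
    and H :: "'a set" +
  fixes X :: ade_type
    and a :: "nat \<Rightarrow> 'a \<Rightarrow> complex"
  assumes reduced: reduced_type
    and valid: "ade_valid X"
    and base: "quotient_base (ade_rank X) a"
    and cartan: "\<And>i j. \<lbrakk>i < ade_rank X; j < ade_rank X\<rbrakk> \<Longrightarrow>
      2 * dual_form (a i) (a j) / dual_form (a j) (a j) = of_int (cartan_matrix X i j)"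
    and rank_gt_1: "1 < rank"
begin

abbreviation n :: nat
  where "n \<equiv> ade_rank X"

definition combination :: "(nat \<Rightarrow> int) \<Rightarrow> 'a \<Rightarrow> complex"
  where "combination k = (\<Sum>i<n. rscale (of_int (k i)) (a i))"

definition coordinates :: "('a \<Rightarrow> complex) \<Rightarrow> (nat \<Rightarrow> int) \<Rightarrow> bool"
  where "coordinates \<alpha> k \<longleftrightarrow> \<alpha> - combination k \<in> isotropic_real_span"

lemma base_root: "i < n \<Longrightarrow> a i \<in> roots"
  using base by (simp add: quotient_base_def)

lemma combination_representable: "combination k \<in> representable"
  unfolding combination_def
  by (intro fun_real.subspace_sum[OF representable_subspace])
    (auto intro: representable_rscale root_representable base_root)

lemma root_coordinates:
  assumes "\<alpha> \<in> roots"
  obtains k where "coordinates \<alpha> k" and "(\<forall>i<n. 0 \<le> k i) \<or> (\<forall>i<n. k i \<le> 0)"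
proof -
  have "coset \<alpha> \<in> quotient_roots" using assms by (simp add: quotient_roots_def)
  then obtain k :: "nat \<Rightarrow> int" where k: "coset \<alpha> = coset (\<Sum>i<n. zscale (k i) (a i))"
    "(\<forall>i<n. 0 \<le> k i) \<or> (\<forall>i<n. k i \<le> 0)"
    using base unfolding quotient_base_def by blast
  have "(\<Sum>i<n. zscale (k i) (a i)) = combination k"
    unfolding combination_def by (intro sum.cong) (auto simp: zscale_def rscale_def)
  then have "coordinates \<alpha> k" using k(1) by (simp add: coset_eq_iff coordinates_def)
  with k(2) that show thesis by blast
qed

lemma coordinates_unique:
  assumes "coordinates \<alpha> k" and "coordinates \<alpha> l" and "i < n"
  shows "k i = l i"
proof -
  let ?c = "\<lambda>i. real_of_int (k i - l i)"
  have "(\<Sum>i<n. rscale (?c i) (a i)) = combination k - combination l"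
    unfolding combination_def sum_subtractf[symmetric]
    by (intro sum.cong) (auto simp: rscale_def fun_eq_iff algebra_simps)
  also have "\<dots> = (\<alpha> - combination l) - (\<alpha> - combination k)" by simp
  also have "\<dots> \<in> isotropic_real_span"
    using fun_real.subspace_diff[OF isotropic_span_subspace] assms(1,2)
    unfolding coordinates_def by blast
  finally have "coset (\<Sum>i<n. rscale (?c i) (a i)) = coset 0"
    unfolding coset_eq_iff by (simp only: diff_0_right)
  moreover have indep: "coset (\<Sum>i<n. rscale (c i) (a i)) = coset 0 \<longrightarrow> (\<forall>i<n. c i = 0)"
    for c :: "nat \<Rightarrow> real" using base unfolding quotient_base_def by blast
  ultimately have "?c i = 0" using assms(3) indep[of ?c] by blast
  then show ?thesis by simp
qed

lemma coordinates_uminus: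
  assumes "coordinates \<alpha> k"
  shows "coordinates (- \<alpha>) (\<lambda>i. - k i)"
proof -
  have "- \<alpha> - combination (\<lambda>i. - k i) = - (\<alpha> - combination k)"
    by (simp add: combination_def sum_negf)
  then show ?thesis
    using assms fun_real.subspace_neg[OF isotropic_span_subspace] unfolding coordinates_def
    by metis
qed

lemma dual_form_coordinates:
  assumes "coordinates \<alpha> k" and "\<beta> \<in> roots"
  shows "dual_form \<alpha> \<beta> = (\<Sum>i<n. of_int (k i) * dual_form (a i) \<beta>)"
proof -
  let ?d = "\<alpha> - combination k"
  have d: "?d \<in> representable" "dual_form ?d \<beta> = 0"
    using isotropic_span_orthogonal assms by (auto simp: coordinates_def)
  have "dual_form (combination k + ?d) \<beta> = dual_form (combination k) \<beta>"
    using d dual_form_add_left[OF combination_representable[of k] d(1) root_representable[OF assms(2)]]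
    by simp
  also have "dual_form (combination k) \<beta>
      = (\<Sum>i<n. dual_form (rscale (of_int (k i)) (a i)) \<beta>)"
    unfolding combination_def using assms(2)
    by (intro dual_form_sum_left) (auto intro: representable_rscale root_representable base_root)
  also have "\<dots> = (\<Sum>i<n. of_int (k i) * dual_form (a i) \<beta>)"
    using assms(2) by (intro sum.cong)
      (auto simp: dual_form_rscale_left root_representable base_root)
  finally show ?thesis by simp
qed

definition len :: complex
  where "len = dual_form (a 0) (a 0)"

lemma base_length:
  assumes "i < n"
  shows "dual_form (a i) (a i) = len"
  unfolding len_def
proof (rule dynkin_connected[OF valid assms, where f = "\<lambda>i. dual_form (a i) (a i)"])
  fix i j assume ij: "i < n" "j < n" "dynkin_adjacent X i j"
  then have "i \<noteq> j" by (simp add: dynkin_adjacent_def)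
  with ij cartan[of i j] cartan[of j i]
  have "2 * dual_form (a i) (a j) / dual_form (a j) (a j) = - 1"
    "2 * dual_form (a i) (a j) / dual_form (a i) (a i) = - 1"
    by (auto simp: cartan_matrix_adjacent dynkin_adjacent_sym[of X j i] dual_form_sym[of "a j" "a i"])
  then show "dual_form (a i) (a i) = dual_form (a j) (a j)"
    by (metis divide_eq_minus_1_iff minus_minus)
qed

lemma rank_positive: "0 < n"
  using valid by (cases X) auto

lemma len_nonzero: "len \<noteq> 0"
  using cartan[OF rank_positive rank_positive] unfolding len_def
  by (auto simp: cartan_matrix_def)

lemma base_form: "i < n \<Longrightarrow> j < n \<Longrightarrow> 2 * dual_form (a i) (a j) = of_int (cartan_matrix X i j) * len"
  using cartan[of i j] base_length[of j] len_nonzero by (simp add: field_simps)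

lemma base_nonisotropic: "i < n \<Longrightarrow> a i \<in> nonisotropic_roots"
  using base_length len_nonzero base_root by (simp add: nonisotropic_iff)

lemma base_form_coordinates:
  assumes "coordinates \<beta> l" and "i < n"
  shows "2 * dual_form (a i) \<beta> = of_int (\<Sum>j<n. l j * cartan_matrix X i j) * len"
proof -
  have "2 * dual_form (a i) \<beta> = (\<Sum>j<n. of_int (l j) * (2 * dual_form (a i) (a j)))"
    unfolding dual_form_sym[of "a i" \<beta>] dual_form_coordinates[OF assms(1) base_root[OF assms(2)]]
      sum_distrib_left
    by (intro sum.cong refl) (simp add: dual_form_sym)
  also have "\<dots> = (\<Sum>j<n. of_int (l j) * (of_int (cartan_matrix X i j) * len))"
    using assms(2) by (intro sum.cong) (auto simp: base_form)
  finally show ?thesis by (simp add: sum_distrib_right mult.assoc)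
qed

lemma dual_form_cartan_form:
  assumes "coordinates \<alpha> k" and "\<beta> \<in> roots" and "coordinates \<beta> l"
  shows "2 * dual_form \<alpha> \<beta> = of_int (cartan_form X k l) * len"
proof -
  have "2 * dual_form \<alpha> \<beta> = (\<Sum>i<n. of_int (k i) * (2 * dual_form (a i) \<beta>))"
    unfolding dual_form_coordinates[OF assms(1,2)] by (simp add: sum_distrib_left algebra_simps)
  also have "\<dots> = (\<Sum>i<n. of_int (k i) * (of_int (\<Sum>j<n. l j * cartan_matrix X i j) * len))"
    using base_form_coordinates[OF assms(3)] by (intro sum.cong) auto
  also have "\<dots> = of_int (cartan_form X k l) * len"
    by (simp add: cartan_form_def sum_distrib_left sum_distrib_right mult.assoc)
  finally show ?thesis .
qed

text \<open>
  The induction is on the height. The length is \<open>len / 2\<close> times the sum of the products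
  \<open>k i * m i\<close>, where \<open>m i\<close> is the Cartan number with \<open>a i\<close>. This sum is a nonzero value of a
  positive semidefinite form, so some \<open>k i\<close> and \<open>m i\<close> are both positive, and the reflection in
  \<open>a i\<close> lowers the height. It changes only the coordinate \<open>k i\<close>; if another coordinate is positive,
  the reflected root has nonnegative coordinates because coordinates of a root have one sign. If
  \<open>i\<close> is the only nonzero coordinate, the root is \<open>a i\<close> up to isotropic vectors because the type is
  reduced.
\<close>

lemma nonisotropic_length_positive:
  assumes "\<alpha> \<in> nonisotropic_roots" and "coordinates \<alpha> k" and "\<And>i. i < n \<Longrightarrow> 0 \<le> k i"
  shows "dual_form \<alpha> \<alpha> = len"
  using assms
proof (induction "nat (\<Sum>i<n. k i)" arbitrary: \<alpha> k rule: less_induct)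
  case less
  note k = less.prems(2) and pos = less.prems(3)
  have root: "\<alpha> \<in> roots" and norm: "dual_form \<alpha> \<alpha> \<noteq> 0"
    using less.prems(1) by (auto simp: nonisotropic_iff)
  define m where "m i = (\<Sum>j<n. k j * cartan_matrix X i j)" for i
  have m: "2 * dual_form (a i) \<alpha> = of_int (m i) * len" if "i < n" for i
    unfolding m_def by (rule base_form_coordinates[OF k that])
  have "cartan_form X k k \<noteq> 0"
    using dual_form_cartan_form[OF k root k] norm by auto
  then have "0 < cartan_form X k k" using cartan_form_nonneg[OF valid, of k] by simp
  moreover have "cartan_form X k k = (\<Sum>i<n. k i * m i)"
    by (simp add: cartan_form_def m_def sum_distrib_left mult.assoc)
  ultimately have "\<not> (\<Sum>i<n. k i * m i) \<le> 0" by simp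
  then have "\<not> (\<forall>i\<in>{..<n}. k i * m i \<le> 0)" 
    using sum_nonpos[of "{..<n}" "\<lambda>i. k i * m i"] by blast
  then obtain i where i: "i < n" "0 < k i * m i" by (auto simp: not_le)
  then have ki: "0 < k i" and mi: "0 < m i"
    using pos[OF i(1)] by (auto simp: zero_less_mult_iff)
  have cn: "cartan_number (a i) \<alpha> = of_int (m i)"
    using m[OF i(1)] len_nonzero by (simp add: cartan_number_def base_length[OF i(1)])
  show ?case
  proof (cases "\<exists>j<n. j \<noteq> i \<and> 0 < k j")
    case False
    then have zero: "k j = 0" if "j < n" "j \<noteq> i" for j using pos[OF that(1)] that by force
    have "combination k = (\<Sum>j<n. if j = i then rscale (of_int (k i)) (a i) else 0)"
      unfolding combination_def using zero by (intro sum.cong) auto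
    also have "\<dots> = rscale (of_int (k i)) (a i)" using i(1) by simp
    finally have "coset (rscale (of_int (k i)) (a i)) = coset \<alpha>"
      using k by (simp add: coset_eq_iff[of \<alpha>] coordinates_def eq_commute[of "coset (rscale _ _)"])
    then have "coset (rscale (of_int (k i)) (a i)) \<in> quotient_roots"
      using root by (simp add: quotient_roots_def)
    moreover have "coset (a i) \<noteq> coset 0"
      using isotropic_span_orthogonal base_root[OF i(1)] base_length[OF i(1)] len_nonzero
      unfolding coset_eq_iff by (metis diff_0_right)
    ultimately have "real_of_int (k i) \<in> {- 1, 0, 1}"
      using reduced base_root[OF i(1)] unfolding reduced_type_def by blast
    then have "k i = 1" using ki by auto
    then have "dual_form \<alpha> \<beta> = dual_form (a i) \<beta>" if "\<beta> \<in> roots" for \<beta>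
    proof -
      have "dual_form \<alpha> \<beta> = (\<Sum>j<n. if j = i then dual_form (a i) \<beta> else 0)"
        unfolding dual_form_coordinates[OF k that] using zero \<open>k i = 1\<close>
        by (intro sum.cong) auto
      then show ?thesis using i(1) by simp
    qed
    then show ?thesis
      using root base_root[OF i(1)] base_length[OF i(1)] dual_form_sym by metis
  next
    case True
    then obtain j where j: "j < n" "j \<noteq> i" "0 < k j" by blast
    define \<beta> where "\<beta> = \<alpha> + rscale (of_nat (nat (m i))) (- a i)"
    define l where "l = k(i := k i - m i)"
    have \<beta>: "\<beta> = \<alpha> - rscale (of_int (m i)) (a i)"
      using mi by (simp add: \<beta>_def rscale_def fun_eq_iff)
    have "\<beta> \<in> roots"
      unfolding \<beta>_def using cn mi by (intro reflection_root[OF base_nonisotropic[OF i(1)] root]) simp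
    have "combination k = (\<Sum>j<n. rscale (of_int (l j)) (a j)
        + (if j = i then rscale (of_int (m i)) (a i) else 0))"
      unfolding combination_def
      by (intro sum.cong) (auto simp: l_def rscale_def fun_eq_iff algebra_simps)
    also have "\<dots> = combination l + rscale (of_int (m i)) (a i)"
      using i(1) by (simp add: combination_def sum.distrib)
    finally have l: "coordinates \<beta> l"
      using k unfolding coordinates_def \<beta> by (simp add: algebra_simps)
    obtain l' where l': "coordinates \<beta> l'" "(\<forall>i<n. 0 \<le> l' i) \<or> (\<forall>i<n. l' i \<le> 0)"
      using root_coordinates[OF \<open>\<beta> \<in> roots\<close>] by blast
    have "l' j = k j" using coordinates_unique[OF l'(1) l j(1)] j(2) by (simp add: l_def)
    then have "\<forall>i<n. 0 \<le> l' i" using l'(2) j by (metis not_le)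
    then have lpos: "0 \<le> l t" if "t < n" for t using coordinates_unique[OF l'(1) l that] that by metis
    have "dual_form \<beta> \<beta> = dual_form \<alpha> \<alpha>"
    proof -
      let ?c = "complex_of_real (- of_int (m i))"
      have "\<beta> = \<alpha> + rscale (- of_int (m i)) (a i)"
        by (simp add: \<beta>)
      then have "dual_form \<beta> \<beta> = dual_form \<alpha> \<alpha> + ?c * (2 * dual_form (a i) \<alpha>) + ?c * (?c * len)"
        using root base_root[OF i(1)] base_length[OF i(1)] dual_form_sym[of \<alpha> "a i"]
        by (simp only: dual_form_simps) (simp add: algebra_simps)
      then show ?thesis unfolding m[OF i(1)] by (simp add: algebra_simps)
    qed
    moreover have "\<beta> \<in> nonisotropic_roots"
      using \<open>\<beta> \<in> roots\<close> calculation norm by (simp add: nonisotropic_iff)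
    moreover have "nat (\<Sum>i<n. l i) < nat (\<Sum>i<n. k i)"
    proof -
      have "(\<Sum>t<n. k t) = (\<Sum>t<n. l t + (if t = i then m i else 0))"
        by (intro sum.cong) (auto simp: l_def)
      then have "(\<Sum>t<n. k t) = (\<Sum>t<n. l t) + m i" using i(1) by (simp add: sum.distrib)
      moreover have "0 \<le> (\<Sum>t<n. l t)" using lpos by (intro sum_nonneg) auto
      ultimately show ?thesis using mi by simp
    qed
    ultimately show ?thesis using less.hyps[of l \<beta>] l lpos by simp
  qed
qed

lemma nonisotropic_length:
  assumes "\<alpha> \<in> nonisotropic_roots"
  shows "dual_form \<alpha> \<alpha> = len"
proof -
  have root: "\<alpha> \<in> roots" using assms by (rule nonisotropic_root)
  obtain k where k: "coordinates \<alpha> k" "(\<forall>i<n. 0 \<le> k i) \<or> (\<forall>i<n. k i \<le> 0)"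
    using root_coordinates[OF root] .
  from k(2) show ?thesis
  proof
    assume "\<forall>i<n. 0 \<le> k i"
    then show ?thesis using nonisotropic_length_positive[OF assms k(1)] by blast
  next
    assume "\<forall>i<n. k i \<le> 0"
    then have "dual_form (- \<alpha>) (- \<alpha>) = len"
      using nonisotropic_length_positive[OF uminus_nonisotropic[OF assms] coordinates_uminus[OF k(1)]]
      by simp
    then show ?thesis using root by (simp add: dual_form_simps)
  qed
qed

lemma nonisotropic_cartan_number:
  "\<alpha> \<in> nonisotropic_roots \<Longrightarrow> cartan_number \<alpha> \<beta> = 2 * dual_form \<alpha> \<beta> / len"
  by (simp add: cartan_number_def nonisotropic_length)

lemma cartan_number_sym:
  "\<alpha> \<in> nonisotropic_roots \<Longrightarrow> \<beta> \<in> nonisotropic_roots \<Longrightarrow> cartan_number \<alpha> \<beta> = cartan_number \<beta> \<alpha>"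
  by (simp add: nonisotropic_cartan_number dual_form_sym)

lemma cartan_number_self: "\<alpha> \<in> nonisotropic_roots \<Longrightarrow> cartan_number \<alpha> \<alpha> = 2"
  using len_nonzero by (simp add: nonisotropic_cartan_number nonisotropic_length)

lemma cartan_form_add: "cartan_form X (\<lambda>i. k i + s * l i) (\<lambda>i. k i + s * l i) =
  cartan_form X k k + s * cartan_form X k l + s * cartan_form X l k + s * s * cartan_form X l l"
  by (simp add: cartan_form_def sum_distrib_left algebra_simps sum.distrib)

text \<open>
  All nonisotropic roots have the same length, so positive semidefiniteness on \<open>\<alpha> + \<beta>\<close> and
  \<open>\<alpha> - \<beta>\<close> bounds the Cartan number in both directions.
\<close>

lemma cartan_number_cases:
  assumes a: "\<alpha> \<in> nonisotropic_roots" and b: "\<beta> \<in> nonisotropic_roots"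
  shows "cartan_number \<alpha> \<beta> \<in> {- 2, - 1, 0, 1, 2}"
proof -
  have ar: "\<alpha> \<in> roots" and br: "\<beta> \<in> roots" using a b nonisotropic_root by auto
  obtain k where k: "coordinates \<alpha> k" using root_coordinates[OF ar] by blast
  obtain l where l: "coordinates \<beta> l" using root_coordinates[OF br] by blast
  have eq: "p = q" if "of_int p * len = of_int q * len" for p q
    using that len_nonzero by simp
  have kk: "cartan_form X k k = 2"
    using dual_form_cartan_form[OF k ar k] nonisotropic_length[OF a] by (intro eq) simp
  have ll: "cartan_form X l l = 2"
    using dual_form_cartan_form[OF l br l] nonisotropic_length[OF b] by (intro eq) simp
  have lk: "cartan_form X l k = cartan_form X k l"
    using dual_form_cartan_form[OF l ar k] dual_form_cartan_form[OF k br l] dual_form_sym[of \<beta> \<alpha>]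
    by (intro eq) metis
  have p: "cartan_number \<alpha> \<beta> = of_int (cartan_form X k l)"
    using dual_form_cartan_form[OF k br l] len_nonzero by (simp add: nonisotropic_cartan_number[OF a])
  have "0 \<le> cartan_form X (\<lambda>i. k i + s * l i) (\<lambda>i. k i + s * l i)" for s
    by (rule cartan_form_nonneg[OF valid])
  from this[of 1] this[of "- 1"] have "- 2 \<le> cartan_form X k l" "cartan_form X k l \<le> 2"
    unfolding cartan_form_add kk ll lk by simp_all
  then have "cartan_form X k l \<in> {- 2, - 1, 0, 1, 2}" by auto
  then show ?thesis unfolding p by auto
qed

lemma cartan_number_uminus_right:
  "\<alpha> \<in> roots \<Longrightarrow> \<beta> \<in> roots \<Longrightarrow> cartan_number \<alpha> (- \<beta>) = - cartan_number \<alpha> \<beta>"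
  by (simp add: cartan_number_def dual_form_simps)

lemma cartan_number_add_right:
  "\<lbrakk>\<alpha> \<in> roots; \<beta> \<in> roots; \<gamma> \<in> roots\<rbrakk>
    \<Longrightarrow> cartan_number \<alpha> (\<beta> + \<gamma>) = cartan_number \<alpha> \<beta> + cartan_number \<alpha> \<gamma>"
  by (simp add: cartan_number_def dual_form_simps add_divide_distrib distrib_left)

lemma norm_sum:
  assumes "\<alpha> \<in> nonisotropic_roots" and "\<beta> \<in> nonisotropic_roots"
  shows "dual_form (\<alpha> + \<beta>) (\<alpha> + \<beta>) = (2 + cartan_number \<alpha> \<beta>) * len"
  using assms len_nonzero
  by (simp add: dual_form_simps nonisotropic_root nonisotropic_length nonisotropic_cartan_number
      dual_form_sym[of \<beta> \<alpha>] field_simps)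

lemma nonisotropic_sum:
  assumes "\<alpha> \<in> nonisotropic_roots" and "\<beta> \<in> nonisotropic_roots" and "cartan_number \<alpha> \<beta> = - 1"
  shows "\<alpha> + \<beta> \<in> nonisotropic_roots"
  using add_root[of \<alpha> \<beta> "- 1"] norm_sum[OF assms(1,2)] assms len_nonzero
  by (simp add: nonisotropic_iff)

lemma cartan_number_of_nonisotropic_sum:
  assumes "\<alpha> \<in> nonisotropic_roots" and "\<beta> \<in> nonisotropic_roots" and "\<alpha> + \<beta> \<in> nonisotropic_roots"
  shows "cartan_number \<alpha> \<beta> = - 1"
proof -
  have "(2 + cartan_number \<alpha> \<beta>) * len = 1 * len"
    using norm_sum[OF assms(1,2)] nonisotropic_length[OF assms(3)] by simp
  then have "2 + cartan_number \<alpha> \<beta> = 1" using len_nonzero by (simp only: mult_cancel_right) simp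
  then have "cartan_number \<alpha> \<beta> = 1 - 2" by (metis add_diff_cancel_left')
  then show ?thesis by simp
qed

lemma isotropic_sum:
  assumes "\<alpha> \<in> nonisotropic_roots" and "\<beta> \<in> nonisotropic_roots" and "cartan_number \<alpha> \<beta> = - 2"
  shows "\<alpha> + \<beta> \<in> isotropic_roots"
  using add_root[of \<alpha> \<beta> "- 2"] norm_sum[OF assms(1,2)] assms
  by (simp add: isotropic_iff nonisotropic_iff)

lemma cartan_number_add_isotropic:
  "\<lbrakk>\<alpha> \<in> roots; \<beta> \<in> roots; \<sigma> \<in> isotropic_roots\<rbrakk> \<Longrightarrow> cartan_number \<alpha> (\<beta> + \<sigma>) = cartan_number \<alpha> \<beta>"
  using isotropic_orthogonal[of \<sigma> \<alpha>]
  by (simp add: cartan_number_add_right isotropic_iff)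
    (simp add: cartan_number_def dual_form_sym[of \<alpha> \<sigma>])

lemma nonisotropic_add_isotropic:
  assumes "\<alpha> \<in> nonisotropic_roots" and "\<sigma> \<in> isotropic_roots" and "\<alpha> + \<sigma> \<in> roots"
  shows "\<alpha> + \<sigma> \<in> nonisotropic_roots"
  using assms isotropic_orthogonal[of \<sigma> \<alpha>] dual_form_sym[of \<alpha> \<sigma>]
  by (simp add: nonisotropic_iff isotropic_iff dual_form_simps)

lemma cartan_number_of_isotropic_sum:
  assumes "\<alpha> \<in> nonisotropic_roots" and "\<beta> \<in> nonisotropic_roots" and "\<alpha> + \<beta> \<in> isotropic_roots"
    and "\<gamma> \<in> roots"
  shows "cartan_number \<gamma> \<beta> = - cartan_number \<gamma> \<alpha>"
  using cartan_number_add_right[of \<gamma> \<alpha> \<beta>] isotropic_orthogonal[OF assms(3,4)] assms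
    nonisotropic_root dual_form_sym[of "\<alpha> + \<beta>" \<gamma>]
  by (simp add: cartan_number_def[of \<gamma> "\<alpha> + \<beta>"] eq_neg_iff_add_eq_0 add.commute)

text \<open>
  The base together with the isotropic roots spans all roots over the reals, so the rank is at most
  the number of nodes.
\<close>

lemma at_least_two_nodes: "2 \<le> n"
proof -
  obtain B where B: "B \<subseteq> root_real_span" "fun_real.independent B"
    "root_real_span \<subseteq> fun_real.span B" "card B = fun_real.dim root_real_span"
    using fun_real.basis_exists by blast
  obtain C where C: "C \<subseteq> isotropic_real_span" "fun_real.independent C"
    "isotropic_real_span \<subseteq> fun_real.span C" "card C = fun_real.dim isotropic_real_span"
    using fun_real.basis_exists by blast
  have r: "1 + card C < card B" using rank_gt_1 B(4) C(4) by (simp add: rank_def)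
  then have "finite B" by (metis card.infinite not_less_zero)
  have "isotropic_real_span \<subseteq> root_real_span"
    unfolding isotropic_real_span_def root_real_span_def
    by (intro fun_real.span_mono) (auto simp: isotropic_roots_def)
  then have "C \<subseteq> fun_real.span B" using C(1) B(3) by blast
  then have "finite C" using fun_real.independent_span_bound[OF \<open>finite B\<close> C(2)] by blast
  let ?S = "a ` {..<n} \<union> C"
  have "roots \<subseteq> fun_real.span ?S"
  proof
    fix \<alpha> assume "\<alpha> \<in> roots"
    then obtain k where k: "coordinates \<alpha> k" using root_coordinates by blast
    have "combination k \<in> fun_real.span ?S"
      unfolding combination_def
      by (intro fun_real.span_sum fun_real.span_scale fun_real.span_base) auto
    moreover have "\<alpha> - combination k \<in> fun_real.span ?S"
      using k C(3) fun_real.span_mono[of C ?S] unfolding coordinates_def by blast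
    ultimately have "combination k + (\<alpha> - combination k) \<in> fun_real.span ?S"
      by (rule fun_real.span_add)
    then show "\<alpha> \<in> fun_real.span ?S" by simp
  qed
  then have "root_real_span \<subseteq> fun_real.span ?S"
    unfolding root_real_span_def by (rule fun_real.span_minimal[OF _ fun_real.subspace_span])
  with B(1) have "B \<subseteq> fun_real.span ?S" by (rule subset_trans)
  moreover have "finite ?S" using \<open>finite C\<close> by simp
  ultimately have "card B \<le> card ?S"
    using fun_real.independent_span_bound[OF _ B(2)] by metis
  also have "\<dots> \<le> card (a ` {..<n}) + card C" by (rule card_Un_le)
  also have "\<dots> \<le> n + card C" using card_image_le[of "{..<n}" a] by simp
  finally show ?thesis using r by linarith
qed

text \<open>
  A Cartan number \<open>2\<close> or \<open>-2\<close> means that \<open>\<beta>\<close> agrees with \<open>\<alpha>\<close> or \<open>- \<alpha>\<close> up to an isotropic root.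
\<close>

lemma cartan_number_parallel:
  assumes a: "\<alpha> \<in> nonisotropic_roots" and b: "\<beta> \<in> nonisotropic_roots"
    and ab: "cartan_number \<alpha> \<beta> \<in> {- 2, 2}" and g: "\<gamma> \<in> roots"
  shows "cartan_number \<gamma> \<beta> \<in> {cartan_number \<gamma> \<alpha>, - cartan_number \<gamma> \<alpha>}"
proof (cases "cartan_number \<alpha> \<beta> = 2")
  case False
  then have "cartan_number \<alpha> \<beta> = - 2" using ab by simp
  then show ?thesis
    using cartan_number_of_isotropic_sum[OF a b isotropic_sum[OF a b] g] by simp
next
  case True
  then have "cartan_number \<alpha> (- \<beta>) = - 2"
    using a b by (simp add: cartan_number_uminus_right nonisotropic_root)
  then have "cartan_number \<gamma> (- \<beta>) = - cartan_number \<gamma> \<alpha>"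
    using cartan_number_of_isotropic_sum[OF a uminus_nonisotropic[OF b]]
      isotropic_sum[OF a uminus_nonisotropic[OF b]] g by blast
  then show ?thesis using g b by (simp add: cartan_number_uminus_right nonisotropic_root)
qed

text \<open>
  The roots parallel to \<open>\<alpha>\<close> are not all roots, as two nodes of the Dynkin diagram are not parallel.
  By irreducibility some other root is not orthogonal to one of them, hence not to \<open>\<alpha>\<close>.
\<close>

lemma exists_neighbour:
  assumes "\<alpha> \<in> nonisotropic_roots"
  obtains \<gamma> where "\<gamma> \<in> nonisotropic_roots" and "cartan_number \<alpha> \<gamma> \<in> {- 1, 1}"
proof -
  define R1 where "R1 = {\<beta> \<in> nonisotropic_roots. cartan_number \<alpha> \<beta> \<in> {- 2, 2}}"
  define R2 where "R2 = nonisotropic_roots - R1"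
  have multiple: "cartan_number \<gamma> \<beta> \<in> {cartan_number \<gamma> \<alpha>, - cartan_number \<gamma> \<alpha>}"
    if "\<beta> \<in> R1" and "\<gamma> \<in> roots" for \<beta> \<gamma>
    using cartan_number_parallel[OF assms _ _ that(2)] that(1) by (simp add: R1_def)
  have "\<alpha> \<in> R1" using assms by (simp add: R1_def cartan_number_self)
  moreover have "R2 \<noteq> {}"
  proof
    assume "R2 = {}"
    then have all: "nonisotropic_roots \<subseteq> R1" by (auto simp: R2_def)
    have a0: "a 0 \<in> nonisotropic_roots" and a1: "a 1 \<in> nonisotropic_roots"
      using at_least_two_nodes by (auto intro: base_nonisotropic)
    have "cartan_number (a 0) (a 1) \<in> {cartan_number (a 0) \<alpha>, - cartan_number (a 0) \<alpha>}"
      using multiple all a1 nonisotropic_root[OF a0] by blast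
    moreover have "cartan_number (a 0) \<alpha> \<in> {- 2, 2}"
      using all a0 cartan_number_sym[OF a0 assms] by (auto simp: R1_def)
    moreover have "cartan_number (a 0) (a 1) = of_int (cartan_matrix X 0 1)"
      using base_form[of 0 1] at_least_two_nodes len_nonzero
      by (simp add: nonisotropic_cartan_number[OF a0])
    ultimately show False
      by (cases "dynkin_adjacent X 0 1") (auto simp: cartan_matrix_adjacent)
  qed
  ultimately obtain \<beta> \<gamma> where bg: "\<beta> \<in> R1" "\<gamma> \<in> R2" "dual_form \<beta> \<gamma> \<noteq> 0"
    using irreducible[of R1 R2] by (auto simp: R1_def R2_def)
  then have g: "\<gamma> \<in> nonisotropic_roots" by (simp add: R2_def)
  have "cartan_number \<gamma> \<beta> \<noteq> 0"
    using bg(3) len_nonzero by (simp add: nonisotropic_cartan_number[OF g] dual_form_sym)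
  then have "cartan_number \<alpha> \<gamma> \<noteq> 0"
    using multiple[OF bg(1) nonisotropic_root[OF g]] cartan_number_sym[OF g assms] by auto
  moreover have "cartan_number \<alpha> \<gamma> \<notin> {- 2, 2}" using bg(2) by (simp add: R1_def R2_def)
  ultimately show thesis using that g cartan_number_cases[OF assms g] by auto
qed

end

section \<open>Eigenvalues of a Cartan automorphism\<close>

locale simply_laced_automorphism = simply_laced_eala scale bracket form H X a
  for scale :: "complex \<Rightarrow> 'a::ab_group_add \<Rightarrow> 'a"
    and bracket :: "'a \<Rightarrow> 'a \<Rightarrow> 'a"
    and form :: "'a \<Rightarrow> 'a \<Rightarrow> complex"
    and H :: "'a set"
    and X :: ade_type
    and a :: "nat \<Rightarrow> 'a \<Rightarrow> complex" +
  fixes \<Psi> :: "'a \<Rightarrow> 'a"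
  assumes cartan_aut: "cartan_automorphism \<Psi>"
    and finite_order: "finite_order \<Psi>"
begin

lemma aut_linear: "Vector_Spaces.linear scale scale \<Psi>"
  and aut_bracket: "\<Psi> (bracket x y) = bracket (\<Psi> x) (\<Psi> y)"
  and aut_H: "h \<in> H \<Longrightarrow> \<Psi> h = h"
  using cartan_aut by (auto simp: cartan_automorphism_def automorphism_def)

lemma aut_add: "\<Psi> (x + y) = \<Psi> x + \<Psi> y"
  using module_hom.add[of scale scale \<Psi> x y] aut_linear by (simp add: Vector_Spaces.linear_def)

lemma aut_scale: "\<Psi> (scale c x) = scale c (\<Psi> x)"
  using module_hom.scale[of scale scale \<Psi> c x] aut_linear by (simp add: Vector_Spaces.linear_def)

lemma aut_zero [simp]: "\<Psi> 0 = 0"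
  using aut_scale[of 0 0] by simp

lemma aut_root_space:
  assumes "x \<in> root_space \<alpha>"
  shows "\<Psi> x \<in> root_space \<alpha>"
proof (rule root_spaceI)
  fix h assume h: "h \<in> H"
  have "bracket h (\<Psi> x) = \<Psi> (bracket h x)" by (simp add: aut_bracket aut_H h)
  then show "bracket h (\<Psi> x) = scale (\<alpha> h) (\<Psi> x)"
    by (simp add: root_spaceD[OF assms h] aut_scale)
qed

abbreviation \<eta> :: "('a \<Rightarrow> complex) \<Rightarrow> complex"
  where "\<eta> \<equiv> eigenvalue \<Psi>"

abbreviation \<psi> :: "('a \<Rightarrow> complex) \<Rightarrow> complex"
  where "\<psi> \<equiv> core_character \<Psi>"

lemma aut_nonisotropic:
  assumes "\<alpha> \<in> nonisotropic_roots" and "x \<in> root_space \<alpha>"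
  shows "\<Psi> x = scale (\<eta> \<alpha>) x"
proof -
  obtain y where y: "y \<in> root_space \<alpha>" "y \<noteq> 0"
    using root_space_nonzero[OF nonisotropic_root[OF assms(1)]] .
  obtain c where c: "\<Psi> y = scale c y"
    using root_space_one_dimensional[OF assms(1) aut_root_space[OF y(1)] y] by blast
  have all: "\<forall>x\<in>root_space \<alpha>. \<Psi> x = scale c x"
  proof
    fix x assume "x \<in> root_space \<alpha>"
    then obtain d where "x = scale d y" using root_space_one_dimensional[OF assms(1) _ y] by blast
    then show "\<Psi> x = scale c x" by (simp add: aut_scale c mult.commute)
  qed
  have "\<eta> \<alpha> = c"
    unfolding eigenvalue_def
  proof (rule the_equality)
    show "\<forall>x\<in>root_space \<alpha>. \<Psi> x = scale c x" by (rule all)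
    fix d assume "\<forall>x\<in>root_space \<alpha>. \<Psi> x = scale d x"
    then have "scale d y = scale c y" using y(1) c by metis
    then show "d = c" using y(2) by simp
  qed
  then show ?thesis using all assms(2) by blast
qed

text \<open>
  The bracket of opposite vectors is a nonzero element of \<open>H\<close>, where \<open>\<Psi>\<close> is the identity.
\<close>

lemma eigenvalue_uminus:
  assumes "\<alpha> \<in> nonisotropic_roots"
  shows "\<eta> \<alpha> * \<eta> (- \<alpha>) = 1"
proof -
  obtain e where e: "e \<in> root_space \<alpha>" "e \<noteq> 0"
    using root_space_nonzero[OF nonisotropic_root[OF assms]] .
  obtain f where f: "f \<in> root_space (- \<alpha>)" and sl2: "sl2_triple e (coroot \<alpha>) f"
    using sl2_triple_exists[OF assms e] by blast
  have "bracket e f \<in> H" using root_space_bracket[OF e(1) f] root_space_zero by simp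
  moreover have "bracket e f \<noteq> 0" using sl2 e(2) by (auto simp: sl2_triple_def)
  moreover have "\<Psi> (bracket e f) = scale (\<eta> \<alpha> * \<eta> (- \<alpha>)) (bracket e f)"
    by (simp add: aut_bracket aut_nonisotropic[OF assms e(1)]
        aut_nonisotropic[OF uminus_nonisotropic[OF assms] f]
        bracket_scale_left bracket_scale_right)
  ultimately have "scale (\<eta> \<alpha> * \<eta> (- \<alpha>)) (bracket e f) = scale 1 (bracket e f)"
    using aut_H by simp
  with \<open>bracket e f \<noteq> 0\<close> show ?thesis by (simp only: scale_right_imp_eq scale_cancel_right) simp
qed

lemma eigenvalue_nonzero: "\<alpha> \<in> nonisotropic_roots \<Longrightarrow> \<eta> \<alpha> \<noteq> 0"
  using eigenvalue_uminus by force

lemma eigenvalue_add: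
  assumes a: "\<alpha> \<in> nonisotropic_roots" and b: "\<beta> \<in> nonisotropic_roots"
    and ab: "\<alpha> + \<beta> \<in> nonisotropic_roots"
  shows "\<eta> (\<alpha> + \<beta>) = \<eta> \<alpha> * \<eta> \<beta>"
proof -
  obtain x where x: "x \<in> root_space \<alpha>" "x \<noteq> 0"
    using root_space_nonzero[OF nonisotropic_root[OF a]] .
  obtain y where y: "y \<in> root_space \<beta>" "y \<noteq> 0"
    using root_space_nonzero[OF nonisotropic_root[OF b]] .
  have "cartan_number \<alpha> \<beta> = of_int (- 1)"
    using cartan_number_of_nonisotropic_sum[OF a b ab] by simp
  then have nz: "bracket x y \<noteq> 0"
    using bracket_nonzero[OF a nonisotropic_root[OF b] _ _ x y, of "- 1"] by simp
  have "scale (\<eta> (\<alpha> + \<beta>)) (bracket x y) = \<Psi> (bracket x y)"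
    by (rule aut_nonisotropic[OF ab root_space_bracket[OF x(1) y(1)], symmetric])
  also have "\<dots> = scale (\<eta> \<alpha> * \<eta> \<beta>) (bracket x y)"
    by (simp add: aut_bracket aut_nonisotropic[OF a x(1)] aut_nonisotropic[OF b y(1)]
        bracket_scale_left bracket_scale_right)
  finally show ?thesis using nz by simp
qed

text \<open>
  The set of all \<open>\<beta>\<close> for which translation by \<open>\<sigma>\<close> gives a root and multiplies the eigenvalue by
  \<open>r\<close> is closed under non-orthogonality, so it is everything by irreducibility. If \<open>(\<alpha>, \<beta>)\<close> is
  positive, \<open>\<gamma> = \<beta> - \<alpha>\<close> is a root and can be added to both \<open>\<alpha>\<close> and \<open>\<alpha> + \<sigma>\<close>. If it is negative,
  \<open>\<alpha> + \<beta>\<close> is an intermediate step, and if \<open>\<alpha>\<close> and \<open>\<beta>\<close> are parallel up to isotropic vectors, a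
  third root that is neither parallel nor orthogonal to them is; here rank greater than one enters.
\<close>

lemma isotropic_shift_constant:
  assumes s: "\<sigma> \<in> isotropic_roots" and a: "\<alpha> \<in> nonisotropic_roots" and as: "\<alpha> + \<sigma> \<in> roots"
    and r: "\<eta> (\<alpha> + \<sigma>) = r * \<eta> \<alpha>" and b: "\<beta> \<in> nonisotropic_roots"
  shows "\<beta> + \<sigma> \<in> nonisotropic_roots \<and> \<eta> (\<beta> + \<sigma>) = r * \<eta> \<beta>"
proof -
  define G where "G = {\<beta> \<in> nonisotropic_roots.
    \<beta> + \<sigma> \<in> nonisotropic_roots \<and> \<eta> (\<beta> + \<sigma>) = r * \<eta> \<beta>}"
  have step1: "\<beta> \<in> G" if \<alpha>: "\<alpha> \<in> G" and \<beta>: "\<beta> \<in> nonisotropic_roots"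
    and c: "cartan_number \<alpha> \<beta> = 1" for \<alpha> \<beta>
  proof -
    have a: "\<alpha> \<in> nonisotropic_roots" "\<alpha> + \<sigma> \<in> nonisotropic_roots" "\<eta> (\<alpha> + \<sigma>) = r * \<eta> \<alpha>"
      using \<alpha> by (auto simp: G_def)
    note roots = nonisotropic_root[OF a(1)] nonisotropic_root[OF \<beta>]
    define \<gamma> where "\<gamma> = \<beta> + - \<alpha>"
    have "cartan_number \<beta> (- \<alpha>) = - 1"
      using c cartan_number_sym[OF a(1) \<beta>] roots by (simp add: cartan_number_uminus_right)
    then have g: "\<gamma> \<in> nonisotropic_roots"
      unfolding \<gamma>_def by (rule nonisotropic_sum[OF \<beta> uminus_nonisotropic[OF a(1)]])
    have "cartan_number \<alpha> \<gamma> = - 1"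
      unfolding \<gamma>_def cartan_number_add_right[OF roots uminus_root[OF roots(1)]]
        cartan_number_uminus_right[OF roots(1) roots(1)] cartan_number_self[OF a(1)] c by simp
    then have ga: "cartan_number \<gamma> \<alpha> = - 1" using cartan_number_sym[OF a(1) g] by simp
    then have "cartan_number \<gamma> (\<alpha> + \<sigma>) = - 1"
      using cartan_number_add_isotropic[OF nonisotropic_root[OF g] roots(1) s] by simp
    then have "\<gamma> + (\<alpha> + \<sigma>) \<in> nonisotropic_roots" by (rule nonisotropic_sum[OF g a(2)])
    moreover have eq: "\<gamma> + \<alpha> = \<beta>" "\<gamma> + (\<alpha> + \<sigma>) = \<beta> + \<sigma>" by (simp_all add: \<gamma>_def)
    ultimately show ?thesis
      using eigenvalue_add[OF g a(1)] eigenvalue_add[OF g a(2)] \<beta> a(3) unfolding G_def eq by simp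
  qed
  have step: "\<beta> \<in> G" if \<alpha>: "\<alpha> \<in> G" and \<beta>: "\<beta> \<in> nonisotropic_roots"
    and c: "cartan_number \<alpha> \<beta> \<in> {- 1, 1}" for \<alpha> \<beta>
  proof (cases "cartan_number \<alpha> \<beta> = 1")
    case True
    then show ?thesis using step1 \<alpha> \<beta> by blast
  next
    case False
    then have c: "cartan_number \<alpha> \<beta> = - 1" using c by simp
    have a: "\<alpha> \<in> nonisotropic_roots" using \<alpha> by (simp add: G_def)
    note roots = nonisotropic_root[OF a] nonisotropic_root[OF \<beta>]
    have ab: "\<alpha> + \<beta> \<in> nonisotropic_roots" by (rule nonisotropic_sum[OF a \<beta> c])
    have "cartan_number \<alpha> (\<alpha> + \<beta>) = 1"
      unfolding cartan_number_add_right[OF roots(1) roots] cartan_number_self[OF a] c by simp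
    then have "\<alpha> + \<beta> \<in> G" by (rule step1[OF \<alpha> ab])
    moreover have "cartan_number \<beta> (\<alpha> + \<beta>) = 1"
      unfolding cartan_number_add_right[OF roots(2) roots] cartan_number_self[OF \<beta>]
        cartan_number_sym[OF \<beta> a] c by simp
    then have "cartan_number (\<alpha> + \<beta>) \<beta> = 1" using cartan_number_sym[OF \<beta> ab] by simp
    ultimately show ?thesis using step1 \<beta> by blast
  qed
  have closed: "\<beta> \<in> G" if \<alpha>: "\<alpha> \<in> G" and \<beta>: "\<beta> \<in> nonisotropic_roots"
    and nz: "dual_form \<alpha> \<beta> \<noteq> 0" for \<alpha> \<beta>
  proof (cases "cartan_number \<alpha> \<beta> \<in> {- 1, 1}")
    case True
    then show ?thesis using step \<alpha> \<beta> by blast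
  next
    case False
    have a: "\<alpha> \<in> nonisotropic_roots" using \<alpha> by (simp add: G_def)
    have "cartan_number \<alpha> \<beta> \<noteq> 0"
      using nz len_nonzero by (simp add: nonisotropic_cartan_number[OF a])
    then have par: "cartan_number \<alpha> \<beta> \<in> {- 2, 2}"
      using False cartan_number_cases[OF a \<beta>] by auto
    obtain \<gamma> where g: "\<gamma> \<in> nonisotropic_roots" "cartan_number \<alpha> \<gamma> \<in> {- 1, 1}"
      using exists_neighbour[OF a] .
    then have "\<gamma> \<in> G" using step \<alpha> by blast
    moreover have "cartan_number \<gamma> \<beta> \<in> {- 1, 1}"
      using cartan_number_parallel[OF a \<beta> par nonisotropic_root[OF g(1)]] g(2)
        cartan_number_sym[OF a g(1)] by auto
    ultimately show ?thesis using step \<beta> by blast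
  qed
  have "\<alpha> \<in> G" using a r nonisotropic_add_isotropic[OF a s as] by (simp add: G_def)
  have "nonisotropic_roots - G = {}"
  proof (rule ccontr)
    assume "nonisotropic_roots - G \<noteq> {}"
    moreover have "nonisotropic_roots = G \<union> (nonisotropic_roots - G)" by (auto simp: G_def)
    ultimately have "\<exists>\<alpha>\<in>G. \<exists>\<beta>\<in>nonisotropic_roots - G. dual_form \<alpha> \<beta> \<noteq> 0"
      using \<open>\<alpha> \<in> G\<close> by (intro irreducible) auto
    then show False using closed by blast
  qed
  then have "\<beta> \<in> G" using b by blast
  then show ?thesis by (simp add: G_def)
qed

section \<open>Roots of the core\<close>

text \<open>
  The isotropic roots that occur in the core are the differences of two nonisotropic roots.
\<close>

definition core_roots :: "('a \<Rightarrow> complex) set"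
  where "core_roots = nonisotropic_roots \<union>
    {\<sigma> \<in> isotropic_roots. \<exists>\<alpha>\<in>nonisotropic_roots. \<alpha> + \<sigma> \<in> roots}"

lemma core_character_nonisotropic: "\<alpha> \<in> nonisotropic_roots \<Longrightarrow> \<psi> \<alpha> = \<eta> \<alpha>"
  by (simp add: core_character_def)

lemma core_character_isotropic:
  assumes s: "\<sigma> \<in> isotropic_roots" "\<sigma> \<in> core_roots" and b: "\<beta> \<in> nonisotropic_roots"
  shows "\<beta> + \<sigma> \<in> nonisotropic_roots \<and> \<eta> (\<beta> + \<sigma>) = \<psi> \<sigma> * \<eta> \<beta>"
proof -
  let ?P = "\<lambda>\<alpha>. \<alpha> \<in> nonisotropic_roots \<and> \<alpha> + \<sigma> \<in> nonisotropic_roots"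
  have ns: "\<sigma> \<notin> nonisotropic_roots" using s(1) by (simp add: nonisotropic_roots_def)
  with s obtain \<alpha>' where "\<alpha>' \<in> nonisotropic_roots" "\<alpha>' + \<sigma> \<in> roots"
    by (auto simp: core_roots_def)
  then have "?P \<alpha>'" using nonisotropic_add_isotropic s(1) by blast
  then have P: "?P (SOME \<alpha>. ?P \<alpha>)" by (rule someI[of ?P])
  define \<alpha> where "\<alpha> = (SOME \<alpha>. ?P \<alpha>)"
  have a: "\<alpha> \<in> nonisotropic_roots" "\<alpha> + \<sigma> \<in> nonisotropic_roots" using P by (auto simp: \<alpha>_def)
  have "\<psi> \<sigma> = \<eta> (\<alpha> + \<sigma>) * \<eta> (- \<alpha>)"
    using ns by (simp add: core_character_def \<alpha>_def Let_def)
  then have "\<eta> (\<alpha> + \<sigma>) = \<psi> \<sigma> * \<eta> \<alpha>"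
    using eigenvalue_uminus[OF a(1)] by (simp add: mult.assoc mult.commute)
  then show ?thesis
    using isotropic_shift_constant[OF s(1) a(1) nonisotropic_root[OF a(2)] _ b] by blast
qed

lemma core_root_cases:
  assumes "\<alpha> \<in> core_roots"
  obtains "\<alpha> \<in> nonisotropic_roots" | "\<alpha> \<in> isotropic_roots"
  using assms by (auto simp: core_roots_def)

lemma core_root: "\<alpha> \<in> core_roots \<Longrightarrow> \<alpha> \<in> roots"
  by (auto simp: core_roots_def isotropic_iff nonisotropic_iff)

lemma core_character_nonzero:
  assumes "\<alpha> \<in> core_roots"
  shows "\<psi> \<alpha> \<noteq> 0"
  using assms
proof (cases rule: core_root_cases)
  case 1
  then show ?thesis by (simp add: core_character_nonisotropic eigenvalue_nonzero)
next
  case 2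
  have "a 0 \<in> nonisotropic_roots" by (rule base_nonisotropic[OF rank_positive])
  then show ?thesis
    using core_character_isotropic[OF 2 assms] eigenvalue_nonzero by fastforce
qed

lemma core_character_add_nonisotropic_isotropic:
  assumes "\<alpha> \<in> nonisotropic_roots" and "\<sigma> \<in> isotropic_roots" and "\<sigma> \<in> core_roots"
  shows "\<alpha> + \<sigma> \<in> core_roots \<and> \<psi> (\<alpha> + \<sigma>) = \<psi> \<alpha> * \<psi> \<sigma>"
  using core_character_isotropic[OF assms(2,3,1)] assms(1)
  by (simp add: core_character_nonisotropic core_roots_def mult.commute)

text \<open>
  If two nonisotropic roots have an isotropic sum \<open>\<sigma>\<close>, then \<open>\<alpha> = - \<beta> + \<sigma>\<close> computes \<open>\<psi> \<sigma>\<close>. For two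
  isotropic roots, translate a nonisotropic root first by one and then by the other, which again
  gives a nonisotropic root.
\<close>

lemma core_character_add:
  assumes \<alpha>: "\<alpha> \<in> core_roots" and \<beta>: "\<beta> \<in> core_roots" and sum: "\<alpha> + \<beta> \<in> roots"
  shows "\<alpha> + \<beta> \<in> core_roots \<and> \<psi> (\<alpha> + \<beta>) = \<psi> \<alpha> * \<psi> \<beta>"
  using \<alpha>
proof (cases rule: core_root_cases)
  case a: 1
  from \<beta> show ?thesis
  proof (cases rule: core_root_cases)
    case b: 1
    show ?thesis
    proof (cases "\<alpha> + \<beta> \<in> nonisotropic_roots")
      case True
      then show ?thesis using eigenvalue_add[OF a b True] a b
        by (simp add: core_character_nonisotropic core_roots_def)
    next
      case False
      then have s: "\<alpha> + \<beta> \<in> isotropic_roots" using sum by (simp add: nonisotropic_roots_def)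
      have "- \<beta> + (\<alpha> + \<beta>) = \<alpha>" by simp
      then have core: "\<alpha> + \<beta> \<in> core_roots"
        using s uminus_nonisotropic[OF b] nonisotropic_root[OF a] unfolding core_roots_def by force
      have "\<eta> \<alpha> = \<psi> (\<alpha> + \<beta>) * \<eta> (- \<beta>)"
        using core_character_isotropic[OF s core uminus_nonisotropic[OF b]]
        unfolding \<open>- \<beta> + (\<alpha> + \<beta>) = \<alpha>\<close> by blast
      then have "\<eta> \<alpha> * \<eta> \<beta> = \<psi> (\<alpha> + \<beta>)"
        using eigenvalue_uminus[OF b] by (simp add: mult.assoc mult.commute)
      then show ?thesis using core a b by (simp add: core_character_nonisotropic)
    qed
  next
    case b: 2
    show ?thesis by (rule core_character_add_nonisotropic_isotropic[OF a b \<beta>])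
  qed
next
  case a: 2
  from \<beta> show ?thesis
  proof (cases rule: core_root_cases)
    case b: 1
    show ?thesis
      using core_character_add_nonisotropic_isotropic[OF b a \<alpha>] by (simp add: ac_simps)
  next
    case b: 2
    have g: "a 0 \<in> nonisotropic_roots" by (rule base_nonisotropic[OF rank_positive])
    note ga = core_character_isotropic[OF a \<alpha> g]
    note gab = core_character_isotropic[OF b \<beta> conjunct1[OF ga]]
    have "dual_form (\<alpha> + \<beta>) (\<alpha> + \<beta>) = 0"
      using a b isotropic_orthogonal[OF a, of \<beta>] dual_form_sym[of \<beta> \<alpha>]
      by (simp add: dual_form_simps isotropic_iff)
    then have s: "\<alpha> + \<beta> \<in> isotropic_roots" using sum by (simp add: isotropic_iff)
    have eq: "a 0 + \<alpha> + \<beta> = a 0 + (\<alpha> + \<beta>)" by (rule add.assoc)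
    have core: "\<alpha> + \<beta> \<in> core_roots"
      using s g conjunct1[OF gab] nonisotropic_root unfolding core_roots_def eq by blast
    have "\<psi> (\<alpha> + \<beta>) * \<eta> (a 0) = \<psi> \<beta> * (\<psi> \<alpha> * \<eta> (a 0))"
      using core_character_isotropic[OF s core g] ga gab unfolding eq by metis
    then show ?thesis using core eigenvalue_nonzero[OF g] by (simp add: mult.commute)
  qed
qed

section \<open>The automorphism on the core\<close>

text \<open>
  The graded subalgebra on whose homogeneous parts \<open>\<Psi>\<close> acts by the core-character. It contains the
  core because the core-character is multiplicative on \<open>core_roots\<close>. Its part at any other root is
  set to zero, which in the end shows that there is no other root.
\<close>

definition diagonal_part :: "('a \<Rightarrow> complex) \<Rightarrow> 'a set"
  where "diagonal_part \<alpha> =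
    {x \<in> root_space \<alpha>. \<Psi> x = scale (\<psi> \<alpha>) x \<and> (\<alpha> \<in> core_roots \<or> x = 0)}"

definition diagonal_subalgebra :: "'a set"
  where "diagonal_subalgebra = span (\<Union>\<alpha>\<in>roots. diagonal_part \<alpha>)"

lemma diagonal_part_subspace: "subspace (diagonal_part \<alpha>)"
  using subspace_add[OF root_space_subspace] subspace_scale[OF root_space_subspace]
  by (auto simp: subspace_def diagonal_part_def aut_add aut_scale scale_right_distrib mult.commute)

lemma bracket_diagonal_part:
  assumes x: "x \<in> diagonal_part \<alpha>" and y: "y \<in> diagonal_part \<beta>"
    and roots: "\<alpha> \<in> roots" "\<beta> \<in> roots"
  shows "bracket x y \<in> diagonal_subalgebra"
proof (cases "bracket x y = 0")
  case True
  then show ?thesis by (simp add: diagonal_subalgebra_def span_zero)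
next
  case False
  then have core: "\<alpha> \<in> core_roots" "\<beta> \<in> core_roots"
    using x y by (auto simp: diagonal_part_def)
  have xy: "bracket x y \<in> root_space (\<alpha> + \<beta>)"
    using x y root_space_bracket by (simp add: diagonal_part_def)
  have sum: "\<alpha> + \<beta> \<in> roots"
    using rootI[OF dual_add xy False] roots roots_dual by blast
  have "\<Psi> (bracket x y) = scale (\<psi> \<alpha> * \<psi> \<beta>) (bracket x y)"
    using x y by (simp add: aut_bracket diagonal_part_def bracket_scale_left bracket_scale_right)
  then have "bracket x y \<in> diagonal_part (\<alpha> + \<beta>)"
    using core_character_add[OF core sum] xy by (simp add: diagonal_part_def)
  then show ?thesis using sum span_base unfolding diagonal_subalgebra_def by blast
qed

lemma diagonal_subalgebra: "subalgebra diagonal_subalgebra"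
proof -
  have sub: "subspace diagonal_subalgebra" unfolding diagonal_subalgebra_def by (rule subspace_span)
  have hom: "bracket x y \<in> diagonal_subalgebra"
    if "x \<in> diagonal_part \<alpha>" "\<alpha> \<in> roots" "y \<in> diagonal_subalgebra" for x y \<alpha>
    using that(3) unfolding diagonal_subalgebra_def
  proof (induction rule: span_induct_alt)
    case base
    then show ?case by (simp add: span_zero)
  next
    case (step c z w)
    then show ?case
      using bracket_diagonal_part[OF that(1) _ that(2)] subspace_add[OF sub] subspace_scale[OF sub]
      unfolding diagonal_subalgebra_def by (auto simp: bracket_add_right bracket_scale_right)
  qed
  have "bracket x y \<in> diagonal_subalgebra"
    if "x \<in> diagonal_subalgebra" "y \<in> diagonal_subalgebra" for x y
    using that(1) unfolding diagonal_subalgebra_def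
  proof (induction rule: span_induct_alt)
    case base
    then show ?case by (simp add: span_zero)
  next
    case (step c z w)
    then show ?case
      using hom[OF _ _ that(2)] subspace_add[OF sub] subspace_scale[OF sub]
      unfolding diagonal_subalgebra_def by (auto simp: bracket_add_left bracket_scale_left)
  qed
  with sub show ?thesis by (simp add: subalgebra_def)
qed

lemma core_minimal:
  assumes "subalgebra S" and "\<And>\<alpha>. \<alpha> \<in> nonisotropic_roots \<Longrightarrow> root_space \<alpha> \<subseteq> S"
  shows "core \<subseteq> S"
  using assms unfolding core_def generated_subalgebra_def by blast

lemma core_subset_diagonal_subalgebra: "core \<subseteq> diagonal_subalgebra"
proof (rule core_minimal[OF diagonal_subalgebra])
  fix \<alpha> assume a: "\<alpha> \<in> nonisotropic_roots"
  then have "root_space \<alpha> \<subseteq> diagonal_part \<alpha>"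
    by (auto simp: diagonal_part_def core_roots_def aut_nonisotropic core_character_nonisotropic)
  then show "root_space \<alpha> \<subseteq> diagonal_subalgebra"
    using nonisotropic_root[OF a] span_base unfolding diagonal_subalgebra_def by blast
qed

text \<open>
  Root spaces are linearly independent because the form pairs \<open>root_space \<sigma>\<close> nondegenerately with
  \<open>root_space (- \<sigma>)\<close> and kills all other root spaces there. So the \<open>\<sigma>\<close>-component of an element of
  the span can be read off from the form.
\<close>

lemma diagonal_subalgebra_homogeneous:
  assumes s: "\<sigma> \<in> roots" and x: "x \<in> root_space \<sigma>" "x \<in> diagonal_subalgebra"
  shows "x \<in> diagonal_part \<sigma>"
proof -
  have "\<exists>p\<in>diagonal_part \<sigma>. \<forall>y\<in>root_space (- \<sigma>). form (x - p) y = 0"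
    using x(2) unfolding diagonal_subalgebra_def
  proof (induction rule: span_induct_alt)
    case base
    show ?case using subspace_0[OF diagonal_part_subspace] by (intro bexI[of _ 0]) auto
  next
    case (step c z w)
    then obtain \<tau> p where t: "\<tau> \<in> roots" "z \<in> diagonal_part \<tau>" and
      p: "p \<in> diagonal_part \<sigma>" "\<forall>y\<in>root_space (- \<sigma>). form (w - p) y = 0" by blast
    show ?case
    proof (cases "\<tau> = \<sigma>")
      case True
      have "scale c z + p \<in> diagonal_part \<sigma>"
        using t(2) p(1) True subspace_add[OF diagonal_part_subspace]
          subspace_scale[OF diagonal_part_subspace] by blast
      moreover have "scale c z + w - (scale c z + p) = w - p" by simp
      ultimately show ?thesis using p(2) by metis
    next
      case False
      then have "\<tau> + - \<sigma> \<noteq> 0" by simp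
      then have "form z y = 0" if "y \<in> root_space (- \<sigma>)" for y
        using form_orthogonal[OF roots_dual[OF t(1)] roots_dual[OF uminus_root[OF s]] _ _ that]
          t(2) by (simp add: diagonal_part_def)
      then have "\<forall>y\<in>root_space (- \<sigma>). form (scale c z + w - p) y = 0"
        using p(2) by (simp add: form_diff_left form_add_left form_scale_left)
      then show ?thesis using p(1) by blast
    qed
  qed
  then obtain p where p: "p \<in> diagonal_part \<sigma>" "\<forall>y\<in>root_space (- \<sigma>). form (x - p) y = 0"
    by blast
  have "x - p \<in> root_space \<sigma>"
    using x(1) p(1) subspace_diff[OF root_space_subspace] by (simp add: diagonal_part_def)
  then have "x - p = 0" using form_pairing_nonzero[OF roots_dual[OF s]] p(2) by blast
  then show ?thesis using p(1) by simp
qed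

section \<open>From the core to the whole algebra\<close>

lemma centralizer_coreI:
  assumes "\<And>\<alpha> y. \<alpha> \<in> nonisotropic_roots \<Longrightarrow> y \<in> root_space \<alpha> \<Longrightarrow> bracket z y = 0"
  shows "z \<in> centralizer core"
proof -
  have "subalgebra {y. bracket z y = 0}"
    by (auto simp: subalgebra_def subspace_def bracket_add_right bracket_scale_right
        bracket_derivation[of z])
  then have "core \<subseteq> {y. bracket z y = 0}" using assms by (intro core_minimal) auto
  then show ?thesis by (auto simp: centralizer_def)
qed

lemma centralizing_diagonal_part:
  assumes "\<sigma> \<in> roots" and "z \<in> root_space \<sigma>"
    and "\<And>\<alpha> y. \<alpha> \<in> nonisotropic_roots \<Longrightarrow> y \<in> root_space \<alpha> \<Longrightarrow> bracket z y = 0"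
  shows "z \<in> diagonal_part \<sigma>"
proof -
  have "z \<in> centralizer core" by (rule centralizer_coreI) (rule assms(3))
  then show ?thesis
    using diagonal_subalgebra_homogeneous[OF assms(1,2)] tame core_subset_diagonal_subalgebra
    by blast
qed

text \<open>
  If \<open>\<sigma>\<close> cannot be added to a nonisotropic root, then \<open>root_space \<sigma>\<close> centralizes the core and hence
  lies in it by tameness, which is impossible.
\<close>

lemma all_roots_core: "core_roots = roots"
proof (intro equalityI subsetI)
  fix \<sigma> assume s: "\<sigma> \<in> roots"
  show "\<sigma> \<in> core_roots"
  proof (rule ccontr)
    assume n: "\<sigma> \<notin> core_roots"
    obtain x where x: "x \<in> root_space \<sigma>" "x \<noteq> 0" using root_space_nonzero[OF s] .
    have "bracket x y = 0" if a: "\<alpha> \<in> nonisotropic_roots" and y: "y \<in> root_space \<alpha>" for \<alpha> y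
    proof (rule ccontr)
      assume "bracket x y \<noteq> 0"
      then have "\<sigma> + \<alpha> \<in> roots"
        using rootI[OF dual_add root_space_bracket[OF x(1) y]] roots_dual s nonisotropic_root[OF a]
        by blast
      then have "\<alpha> + \<sigma> \<in> roots" by (simp only: add.commute)
      then show False using n s a by (auto simp: core_roots_def nonisotropic_roots_def)
    qed
    then have "x \<in> diagonal_part \<sigma>" by (rule centralizing_diagonal_part[OF s x(1)])
    then show False using n x(2) by (simp add: diagonal_part_def)
  qed
qed (rule core_root)

text \<open>
  For \<open>x\<close> in an isotropic root space, \<open>z = \<Psi> x - \<psi> \<sigma> x\<close> centralizes the core, so it lies in the core
  and is an eigenvector with eigenvalue \<open>\<psi> \<sigma>\<close>. Thus \<open>\<Psi>\<close> acts on the span of \<open>x\<close> and \<open>z\<close> by a Jordan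
  block, which has finite order only if \<open>z = 0\<close>.
\<close>

lemma aut_isotropic:
  assumes s: "\<sigma> \<in> isotropic_roots" and x: "x \<in> root_space \<sigma>"
  shows "\<Psi> x = scale (\<psi> \<sigma>) x"
proof -
  let ?r = "\<psi> \<sigma>"
  have sr: "\<sigma> \<in> roots" using s by (simp add: isotropic_iff)
  then have sc: "\<sigma> \<in> core_roots" by (simp add: all_roots_core)
  define z where "z = \<Psi> x - scale ?r x"
  have z: "z \<in> root_space \<sigma>"
    unfolding z_def using aut_root_space[OF x] x subspace_diff[OF root_space_subspace]
      subspace_scale[OF root_space_subspace] by blast
  have "bracket z y = 0" if a: "\<alpha> \<in> nonisotropic_roots" and y: "y \<in> root_space \<alpha>" for \<alpha> y
  proof -
    have as: "\<alpha> + \<sigma> \<in> nonisotropic_roots" "\<eta> (\<alpha> + \<sigma>) = ?r * \<eta> \<alpha>"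
      using core_character_isotropic[OF s sc a] by auto
    have "bracket x y \<in> root_space (\<alpha> + \<sigma>)"
      using root_space_bracket[OF x y] by (simp only: add.commute)
    then have "\<Psi> (bracket x y) = scale (?r * \<eta> \<alpha>) (bracket x y)"
      using aut_nonisotropic[OF as(1)] as(2) by simp
    then have "scale (\<eta> \<alpha>) (bracket (\<Psi> x) y) = scale (\<eta> \<alpha>) (scale ?r (bracket x y))"
      by (simp add: aut_bracket aut_nonisotropic[OF a y] bracket_scale_right mult.commute)
    then have "bracket (\<Psi> x) y = scale ?r (bracket x y)"
      using eigenvalue_nonzero[OF a] by (simp only: scale_cancel_left) simp
    then show ?thesis by (simp add: z_def bracket_diff_left bracket_scale_left)
  qed
  then have "z \<in> diagonal_part \<sigma>" by (rule centralizing_diagonal_part[OF sr z])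
  then have Pz: "\<Psi> z = scale ?r z" by (simp add: diagonal_part_def)
  have Px: "\<Psi> x = scale ?r x + z" by (simp add: z_def)
  have powz: "(\<Psi> ^^ k) z = scale (?r ^ k) z" for k
    by (induction k) (simp_all add: Pz aut_scale mult.commute)
  have powx: "(\<Psi> ^^ Suc k) x = scale (?r ^ Suc k) x + scale (of_nat (Suc k) * ?r ^ k) z" for k
  proof (induction k)
    case (Suc k)
    have c: "?r ^ Suc k + of_nat (Suc k) * ?r ^ k * ?r = of_nat (Suc (Suc k)) * ?r ^ Suc k"
      by (simp add: algebra_simps)
    have "(\<Psi> ^^ Suc (Suc k)) x = \<Psi> ((\<Psi> ^^ Suc k) x)" by simp
    also have "\<dots> = scale (?r ^ Suc k) (scale ?r x + z) + scale (of_nat (Suc k) * ?r ^ k) (scale ?r z)"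
      unfolding Suc by (simp only: aut_add aut_scale Px Pz)
    also have "\<dots> = scale (?r ^ Suc (Suc k)) x
        + scale (?r ^ Suc k + of_nat (Suc k) * ?r ^ k * ?r) z"
      by (simp add: scale_right_distrib scale_left_distrib mult_ac del: of_nat_Suc)
    finally show ?case unfolding c .
  qed (simp add: Px)
  obtain m where "0 < m" and idm: "\<Psi> ^^ m = id" using finite_order by (auto simp: finite_order_def)
  then obtain k where m: "m = Suc k" by (cases m) auto
  have "z = 0"
  proof (rule ccontr)
    assume "z \<noteq> 0"
    have "scale (?r ^ m) z = scale 1 z" using powz[of m] idm by simp
    then have rm: "?r ^ m = 1" using \<open>z \<noteq> 0\<close> by (simp only: scale_cancel_right) simp
    have "scale (of_nat (Suc k) * ?r ^ k) z = 0"
      using powx[of k] idm rm unfolding m[symmetric] by simp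
    then show False using \<open>z \<noteq> 0\<close> core_character_nonzero[OF sc] by (simp del: of_nat_Suc)
  qed
  then show ?thesis using Px by simp
qed

lemma diagonal_and_character: "diagonal \<Psi> \<and> is_character \<psi>"
proof
  show "diagonal \<Psi>"
    unfolding diagonal_def
  proof
    fix \<alpha> assume "\<alpha> \<in> roots"
    then consider "\<alpha> \<in> nonisotropic_roots" | "\<alpha> \<in> isotropic_roots"
      by (auto simp: nonisotropic_roots_def)
    then show "\<exists>c. \<forall>x\<in>root_space \<alpha>. \<Psi> x = scale c x"
      by cases (use aut_nonisotropic aut_isotropic in blast)+
  qed
  show "is_character \<psi>"
    unfolding is_character_def
    using core_character_nonzero core_character_add all_roots_core by blast
qed

end

theorem proposition4p2p1:
  fixes scale :: "complex \<Rightarrow> 'a::ab_group_add \<Rightarrow> 'a"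
    and bracket :: "'a \<Rightarrow> 'a \<Rightarrow> 'a"
    and form :: "'a \<Rightarrow> 'a \<Rightarrow> complex"
    and H :: "'a set"
    and \<Psi> :: "'a \<Rightarrow> 'a"
  assumes "eala scale bracket form H"
    and "lie_datum.reduced_type scale bracket form H"
    and "lie_datum.simply_laced scale bracket form H"
    and "1 < lie_datum.rank scale bracket form H"
    and "lie_datum.cartan_automorphism scale bracket H \<Psi>"
    and "finite_order \<Psi>"
  shows "lie_datum.diagonal scale bracket H \<Psi> \<and>
    lie_datum.is_character scale bracket H
      (lie_datum.core_character scale bracket form H \<Psi>)"
proof -
  interpret eala scale bracket form H by fact
  obtain X where "has_type X" using assms(3) by (auto simp: simply_laced_def)
  then obtain a where "simply_laced_eala scale bracket form H X a"
    using assms(1,2,4)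
    by (auto simp: has_type_def simply_laced_eala_def simply_laced_eala_axioms_def)
  then have "simply_laced_automorphism scale bracket form H X a \<Psi>"
    using assms(5,6)
    by (simp add: simply_laced_automorphism_def simply_laced_automorphism_axioms_def)
  then show ?thesis by (rule simply_laced_automorphism.diagonal_and_character)
qed

end
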